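(* Let $j\in\frac12\mathbb{N}$ be a spin, $N\geq1$ an integer, $\mathcal{H}_j$ the spin $j$ unitary irreducible representation space of $\mathrm{SU}(2)$, $\mathrm{Inv}(\mathcal{H}_j^{\otimes N})$ the space of tensors in $\mathcal{H}_j^{\otimes N}$ invariant under the action of $\mathrm{SU}(2)$, and $S_N$ the group of permutations of $N$ elements. (i) The subspace $\mathrm{Inv}(\mathcal{H}_j^{\otimes N})$ is invariant under the right action of $S_N$ on $\mathcal{H}_j^{\otimes N}$ defined by $(v_1\otimes\cdots\otimes v_N)\cdot\sigma=v_{\sigma(1)}\otimes\cdots\otimes v_{\sigma(N)}$, $v_i\in\mathcal{H}_j$. (ii) Let $$B=\{b\in\mathrm{End}(\mathrm{Inv}(\mathcal{H}_j^{\otimes N})) : b(\iota\cdot\sigma)=b(\iota)\cdot\sigma\ \ \forall \iota\in\mathrm{Inv}(\mathcal{H}_j^{\otimes N}),\ \sigma\in S_N\}$$ be the commutator algebra. For a standard $\lambda$-tableau $T_\lambda$ on a Young diagram $\lambda$ with $N$ boxes, let $e_{T_\lambda}=\frac{\dim V_\lambda}{N!}c_{T_\lambda}\in\mathbb{C}S_N$ be the idempotent corresponding to the Young symmetrizer $c_{T_\lambda}$, and let $\mathrm{Inv}_{T_\lambda}(\mathcal{H}_j^{\otimes N})=\mathrm{Inv}(\mathcal{H}_j^{\otimes N})\,e_{T_\lambda}$ be the image of $e_{T_\lambda}$. Then $\mathrm{Inv}(\mathcal{H}_j^{\otimes N})$ has the following decomposition into irreducible left $B$-modules: $$\mathrm{Inv}(\mathcal{H}_j^{\otimes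 N})=\bigoplus_\lambda\bigoplus_{T_\lambda}\mathrm{Inv}_{T_\lambda}(\mathcal{H}_j^{\otimes N}),$$ where $\lambda$ runs through all Young diagrams with $N$ boxes and $T_\lambda$ runs through all standard $\lambda$-tableaux. That is, the internal direct sum equality holds, and each summand is a $B$-submodule that is either zero or irreducible.
   Context: $\mathrm{SU}(2)$ acts on $\mathcal{H}_j^{\otimes N}$ by $\rho_j(u)^{\otimes N}$, where $\rho_j$ is the spin $j$ representation (of dimension $2j+1$). The right action of $S_N$ extends linearly to a right action of the group algebra $\mathbb{C}S_N$ (basis $e_g$, $g\in S_N$, product $e_ge_h=e_{gh}$, with $gh=g\circ h$). A Young diagram $\lambda$ with $N$ boxes corresponds to a partition $\lambda_1\ge\cdots\ge\lambda_k\ge1$ of $N$, with $\lambda_i$ boxes in row $i$. A $\lambda$-tableau is a bijective filling of the boxes with $1,\ldots,N$; it is standard if all rows and columns are increasing. For a $\lambda$-tableau $t$, let $P(t)$ (resp. $Q(t)$) be the subgroup of $S_N$ preserving each row (resp. each column) of $t$ as a set, $a(t)=\sum_{g\in P(t)}e_g$, $b(t)=\sum_{g\in Q(t)}\mathrm{sgn}(g)e_g$, and let the Young symmetrizer be $c_t=a(t)\,b(t)\in\mathbb{C}S_N$. $V_\lambda=\mathbb{C}S_N\,c_{t}$ with $t$ the canonical $\lambda$-tableau (boxes filled by consecutive numbers, row by row); it is the irreducible representation of $S_N$ labelled by $\lambda$. *)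

theory Defs
  imports "HOL-Analysis.Analysis" "HOL-Library.Function_Algebras"
    "HOL-Computational_Algebra.Polynomial"
begin

section \<open>Spaces of complex-valued functions\<close>

text \<open>Tensors and elements of the group algebra are complex-valued functions on multi-indices and
  on permutations. Addition is the pointwise one from Function_Algebras.\<close>

definition cscale :: "complex \<Rightarrow> ('a \<Rightarrow> complex) \<Rightarrow> 'a \<Rightarrow> complex"
  where "cscale c f = (\<lambda>x. c * f x)"

global_interpretation cfun: vector_space "cscale :: complex \<Rightarrow> ('a \<Rightarrow> complex) \<Rightarrow> 'a \<Rightarrow> complex"
  by unfold_locales (auto simp: cscale_def fun_eq_iff algebra_simps)

lemma sum_fun_apply: "(sum f A :: 'a \<Rightarrow> complex) x = (\<Sum>i\<in>A. f i x)"
  by (induction A rule: infinite_finite_induct) auto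

definition internal_direct_sum ::
  "('a \<Rightarrow> complex) set \<Rightarrow> 'i set \<Rightarrow> ('i \<Rightarrow> ('a \<Rightarrow> complex) set) \<Rightarrow> bool"
  where "internal_direct_sum V I W \<longleftrightarrow>
    finite I \<and> cfun.subspace V \<and> (\<forall>i\<in>I. cfun.subspace (W i) \<and> W i \<subseteq> V) \<and>
    (\<forall>v\<in>V. \<exists>!w. w \<in> Pi\<^sub>E I W \<and> v = (\<Sum>i\<in>I. w i))"


section \<open>The spin representation\<close>

definition SU2 :: "(complex ^ 2 ^ 2) set"
  where "SU2 = {u. u ** (\<chi> i k. cnj (u $ k $ i)) = mat 1 \<and> det u = 1}"

text \<open>The representation space of spin \<open>j\<close>, with \<open>n = 2j\<close>, is the space of homogeneous polynomials
  of degree \<open>n\<close> in two variables, on which \<open>u\<close> acts by \<open>(u \<cdot> p)(z) = p(z u)\<close>, \<open>z\<close> a row vector.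
  Its inner product makes the following polynomials, \<open>k \<le> n\<close>, an orthonormal basis.\<close>

definition spin_basis :: "nat \<Rightarrow> nat \<Rightarrow> complex \<Rightarrow> complex \<Rightarrow> complex"
  where "spin_basis n k x y = x ^ k * y ^ (n - k) / of_real (sqrt (fact k * fact (n - k)))"

text \<open>The matrix of \<open>u\<close> in this basis; the lemmas \<open>spin_mat_action\<close>, \<open>spin_mat_mult\<close>,
  \<open>spin_mat_one\<close> and \<open>spin_mat_unitary\<close> below confirm that it is the one of the unitary
  representation just described. Vectors of the spin representation are functions
  \<open>nat \<Rightarrow> complex\<close> of the index \<open>k \<le> n\<close>.\<close>

definition spin_mat :: "nat \<Rightarrow> complex ^ 2 ^ 2 \<Rightarrow> nat \<Rightarrow> nat \<Rightarrow> complex"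
  where "spin_mat n u k l =
    of_real (sqrt (fact k * fact (n - k)) / sqrt (fact l * fact (n - l))) *
    coeff ([:u $ 2 $ 1, u $ 1 $ 1:] ^ l * [:u $ 2 $ 2, u $ 1 $ 2:] ^ (n - l)) k"

definition spin_rep :: "nat \<Rightarrow> complex ^ 2 ^ 2 \<Rightarrow> (nat \<Rightarrow> complex) \<Rightarrow> nat \<Rightarrow> complex"
  where "spin_rep n u v = (\<lambda>k. if k \<le> n then \<Sum>l\<le>n. spin_mat n u k l * v l else 0)"


section \<open>Tensors and invariant tensors\<close>

text \<open>With \<open>n = 2j\<close>, a tensor is given by its components with respect to the product basis, which
  is indexed by the multi-indices \<open>{1..N} \<rightarrow> {0..n}\<close>.\<close>

definition multi_indices :: "nat \<Rightarrow> nat \<Rightarrow> (nat \<Rightarrow> nat) set"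
  where "multi_indices n N = {1..N} \<rightarrow>\<^sub>E {..n}"

definition tensors :: "nat \<Rightarrow> nat \<Rightarrow> ((nat \<Rightarrow> nat) \<Rightarrow> complex) set"
  where "tensors n N = {t. \<forall>m. m \<notin> multi_indices n N \<longrightarrow> t m = 0}"

definition pure_tensor :: "nat \<Rightarrow> nat \<Rightarrow> (nat \<Rightarrow> nat \<Rightarrow> complex) \<Rightarrow> (nat \<Rightarrow> nat) \<Rightarrow> complex"
  where "pure_tensor n N v =
    (\<lambda>m. if m \<in> multi_indices n N then \<Prod>i\<in>{1..N}. v i (m i) else 0)"

definition tensor_rep ::
  "nat \<Rightarrow> nat \<Rightarrow> complex ^ 2 ^ 2 \<Rightarrow> ((nat \<Rightarrow> nat) \<Rightarrow> complex) \<Rightarrow> (nat \<Rightarrow> nat) \<Rightarrow> complex"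
  where "tensor_rep n N u t =
    (\<lambda>m. if m \<in> multi_indices n N
      then \<Sum>m'\<in>multi_indices n N. (\<Prod>i\<in>{1..N}. spin_mat n u (m i) (m' i)) * t m' else 0)"

definition Inv :: "real \<Rightarrow> nat \<Rightarrow> ((nat \<Rightarrow> nat) \<Rightarrow> complex) set"
  where "Inv j N = (let n = nat \<lfloor>2 * j\<rfloor> in
    {t \<in> tensors n N. \<forall>u\<in>SU2. tensor_rep n N u t = t})"


section \<open>The right action of the symmetric group and its group algebra\<close>

definition Sym :: "nat \<Rightarrow> (nat \<Rightarrow> nat) set"
  where "Sym N = {\<sigma>. \<sigma> permutes {1..N}}"

text \<open>In components, the linear extension of
  \<open>(v\<^sub>1 \<otimes> \<dots> \<otimes> v\<^sub>N) \<cdot> \<sigma> = v\<^bsub>\<sigma>(1)\<^esub> \<otimes> \<dots> \<otimes> v\<^bsub>\<sigma>(N)\<^esub>\<close>; see \<open>perm_act_pure\<close> and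
  \<open>pure_tensors_span\<close> below.\<close>

definition perm_act :: "((nat \<Rightarrow> nat) \<Rightarrow> complex) \<Rightarrow> (nat \<Rightarrow> nat) \<Rightarrow> (nat \<Rightarrow> nat) \<Rightarrow> complex"
  where "perm_act t \<sigma> = (\<lambda>m. t (m \<circ> inv \<sigma>))"

definition group_algebra :: "nat \<Rightarrow> ((nat \<Rightarrow> nat) \<Rightarrow> complex) set"
  where "group_algebra N = {a. \<forall>g. g \<notin> Sym N \<longrightarrow> a g = 0}"

definition ga_basis :: "(nat \<Rightarrow> nat) \<Rightarrow> (nat \<Rightarrow> nat) \<Rightarrow> complex"
  where "ga_basis g = (\<lambda>h. if h = g then 1 else 0)"

definition ga_mult ::
  "nat \<Rightarrow> ((nat \<Rightarrow> nat) \<Rightarrow> complex) \<Rightarrow> ((nat \<Rightarrow> nat) \<Rightarrow> complex) \<Rightarrow> (nat \<Rightarrow> nat) \<Rightarrow> complex"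
  where "ga_mult N a b =
    (\<Sum>g\<in>Sym N. \<Sum>h\<in>Sym N. cscale (a g * b h) (ga_basis (g \<circ> h)))"

definition ga_act ::
  "nat \<Rightarrow> ((nat \<Rightarrow> nat) \<Rightarrow> complex) \<Rightarrow> ((nat \<Rightarrow> nat) \<Rightarrow> complex) \<Rightarrow> (nat \<Rightarrow> nat) \<Rightarrow> complex"
  where "ga_act N t a = (\<Sum>g\<in>Sym N. cscale (a g) (perm_act t g))"


section \<open>Young diagrams, tableaux and symmetrizers\<close>

definition young_diagrams :: "nat \<Rightarrow> nat list set"
  where "young_diagrams N =
    {lam. sorted_wrt (\<ge>) lam \<and> (\<forall>x\<in>set lam. 1 \<le> x) \<and> sum_list lam = N}"

text \<open>Boxes are pairs (row, column), both counted from 0.\<close>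

definition boxes :: "nat list \<Rightarrow> (nat \<times> nat) set"
  where "boxes lam = {(r, c). r < length lam \<and> c < lam ! r}"

text \<open>Extensionality makes different tableaux differ on some box.\<close>

definition tableaux :: "nat list \<Rightarrow> (nat \<times> nat \<Rightarrow> nat) set"
  where "tableaux lam =
    {t \<in> extensional (boxes lam). bij_betw t (boxes lam) {1..sum_list lam}}"

definition standard_tableaux :: "nat list \<Rightarrow> (nat \<times> nat \<Rightarrow> nat) set"
  where "standard_tableaux lam = {t \<in> tableaux lam.
    (\<forall>r c c'. (r, c) \<in> boxes lam \<and> (r, c') \<in> boxes lam \<and> c < c' \<longrightarrow> t (r, c) < t (r, c')) \<and>
    (\<forall>r r' c. (r, c) \<in> boxes lam \<and> (r', c) \<in> boxes lam \<and> r < r' \<longrightarrow> t (r, c) < t (r', c))}"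

definition canonical_tableau :: "nat list \<Rightarrow> nat \<times> nat \<Rightarrow> nat"
  where "canonical_tableau lam =
    restrict (\<lambda>(r, c). sum_list (take r lam) + c + 1) (boxes lam)"

definition row_entries :: "nat list \<Rightarrow> (nat \<times> nat \<Rightarrow> nat) \<Rightarrow> nat \<Rightarrow> nat set"
  where "row_entries lam t r = t ` {b \<in> boxes lam. fst b = r}"

definition col_entries :: "nat list \<Rightarrow> (nat \<times> nat \<Rightarrow> nat) \<Rightarrow> nat \<Rightarrow> nat set"
  where "col_entries lam t c = t ` {b \<in> boxes lam. snd b = c}"

definition row_group :: "nat list \<Rightarrow> (nat \<times> nat \<Rightarrow> nat) \<Rightarrow> (nat \<Rightarrow> nat) set"
  where "row_group lam t =
    {g \<in> Sym (sum_list lam). \<forall>r. g ` row_entries lam t r = row_entries lam t r}"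

definition col_group :: "nat list \<Rightarrow> (nat \<times> nat \<Rightarrow> nat) \<Rightarrow> (nat \<Rightarrow> nat) set"
  where "col_group lam t =
    {g \<in> Sym (sum_list lam). \<forall>c. g ` col_entries lam t c = col_entries lam t c}"

definition young_symmetrizer :: "nat list \<Rightarrow> (nat \<times> nat \<Rightarrow> nat) \<Rightarrow> (nat \<Rightarrow> nat) \<Rightarrow> complex"
  where "young_symmetrizer lam t = ga_mult (sum_list lam)
    (\<Sum>g\<in>row_group lam t. ga_basis g)
    (\<Sum>g\<in>col_group lam t. cscale (of_int (sign g)) (ga_basis g))"

definition specht_module :: "nat list \<Rightarrow> ((nat \<Rightarrow> nat) \<Rightarrow> complex) set"
  where "specht_module lam =
    (\<lambda>x. ga_mult (sum_list lam) x (young_symmetrizer lam (canonical_tableau lam)))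
      ` group_algebra (sum_list lam)"

definition young_idempotent :: "nat list \<Rightarrow> (nat \<times> nat \<Rightarrow> nat) \<Rightarrow> (nat \<Rightarrow> nat) \<Rightarrow> complex"
  where "young_idempotent lam t =
    cscale (of_nat (cfun.dim (specht_module lam)) / fact (sum_list lam)) (young_symmetrizer lam t)"

definition Inv_tableau ::
  "real \<Rightarrow> nat \<Rightarrow> nat list \<Rightarrow> (nat \<times> nat \<Rightarrow> nat) \<Rightarrow> ((nat \<Rightarrow> nat) \<Rightarrow> complex) set"
  where "Inv_tableau j N lam t = (\<lambda>\<iota>. ga_act N \<iota> (young_idempotent lam t)) ` Inv j N"


section \<open>The commutator algebra and its modules\<close>

text \<open>Endomorphisms of \<open>V\<close> are extensional, so that they are determined by their values on \<open>V\<close>.\<close>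

definition endomorphisms :: "('a \<Rightarrow> complex) set \<Rightarrow> (('a \<Rightarrow> complex) \<Rightarrow> 'a \<Rightarrow> complex) set"
  where "endomorphisms V = {b \<in> V \<rightarrow>\<^sub>E V.
    (\<forall>x\<in>V. \<forall>y\<in>V. b (x + y) = b x + b y) \<and> (\<forall>c. \<forall>x\<in>V. b (cscale c x) = cscale c (b x))}"

definition commutator_algebra ::
  "real \<Rightarrow> nat \<Rightarrow> (((nat \<Rightarrow> nat) \<Rightarrow> complex) \<Rightarrow> (nat \<Rightarrow> nat) \<Rightarrow> complex) set"
  where "commutator_algebra j N = {b \<in> endomorphisms (Inv j N).
    \<forall>\<iota>\<in>Inv j N. \<forall>\<sigma>\<in>Sym N. b (perm_act \<iota> \<sigma>) = perm_act (b \<iota>) \<sigma>}"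

definition submodule ::
  "(('a \<Rightarrow> complex) \<Rightarrow> 'a \<Rightarrow> complex) set \<Rightarrow> ('a \<Rightarrow> complex) set \<Rightarrow> ('a \<Rightarrow> complex) set \<Rightarrow> bool"
  where "submodule B V W \<longleftrightarrow> cfun.subspace W \<and> W \<subseteq> V \<and> (\<forall>b\<in>B. \<forall>w\<in>W. b w \<in> W)"

definition irreducible_submodule ::
  "(('a \<Rightarrow> complex) \<Rightarrow> 'a \<Rightarrow> complex) set \<Rightarrow> ('a \<Rightarrow> complex) set \<Rightarrow> ('a \<Rightarrow> complex) set \<Rightarrow> bool"
  where "irreducible_submodule B V W \<longleftrightarrow>
    submodule B V W \<and> W \<noteq> {0} \<and> (\<forall>U. submodule B V U \<and> U \<subseteq> W \<longrightarrow> U = {0} \<or> U = W)"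


section \<open>Properties confirming the definitions\<close>

subsection \<open>The spin representation\<close>

lemma poly_eq_sum_le:
  fixes x :: complex
  assumes "degree p \<le> n"
  shows "poly p x = (\<Sum>k\<le>n. coeff p k * x ^ k)"
proof -
  have "poly p x = (\<Sum>k\<le>degree p. coeff p k * x ^ k)" by (rule poly_altdef)
  also have "\<dots> = (\<Sum>k\<le>n. coeff p k * x ^ k)"
    using assms by (intro sum.mono_neutral_left) (auto simp: coeff_eq_0)
  finally show ?thesis .
qed

definition hom_eval :: "nat \<Rightarrow> complex poly \<Rightarrow> complex \<Rightarrow> complex \<Rightarrow> complex"
  where "hom_eval n p x y = (\<Sum>k\<le>n. coeff p k * x ^ k * y ^ (n - k))"

lemma hom_eval_nz:
  assumes "degree p \<le> n" "y \<noteq> 0"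
  shows "hom_eval n p x y = y ^ n * poly p (x / y)"
  unfolding hom_eval_def poly_eq_sum_le[OF assms(1)] sum_distrib_left
  using assms(2) by (intro sum.cong) (auto simp: power_divide power_diff)

lemma coeff_mult_top:
  fixes p q :: "complex poly"
  assumes "degree p \<le> a" "degree q \<le> b"
  shows "coeff (p * q) (a + b) = coeff p a * coeff q b"
proof -
  have "coeff (p * q) (a + b) = (\<Sum>i\<le>a + b. coeff p i * coeff q (a + b - i))"
    by (rule coeff_mult)
  also have "\<dots> = (\<Sum>i\<le>a + b. if i = a then coeff p a * coeff q b else 0)"
  proof (rule sum.cong[OF refl])
    fix i assume "i \<in> {..a + b}"
    show "coeff p i * coeff q (a + b - i) = (if i = a then coeff p a * coeff q b else 0)"
    proof (cases i a rule: linorder_cases)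
      case less
      then have "coeff q (a + b - i) = 0" using assms(2) by (intro coeff_eq_0) linarith
      then show ?thesis using less by simp
    next
      case greater
      then have "coeff p i = 0" using assms(1) by (intro coeff_eq_0) linarith
      then show ?thesis using greater by simp
    qed simp
  qed
  finally show ?thesis by simp
qed

lemma hom_eval_zero: "hom_eval n p x 0 = coeff p n * x ^ n"
proof -
  have "hom_eval n p x 0 = (\<Sum>k\<le>n. if k = n then coeff p n * x ^ n else 0)"
    unfolding hom_eval_def by (intro sum.cong) (auto simp: power_0_left)
  then show ?thesis by simp
qed

lemma hom_eval_mult:
  assumes "degree p \<le> a" "degree q \<le> b"
  shows "hom_eval (a + b) (p * q) x y = hom_eval a p x y * hom_eval b q x y"
proof (cases "y = 0")
  case True
  then show ?thesis by (simp add: hom_eval_zero coeff_mult_top[OF assms] power_add)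
next
  case False
  have "degree (p * q) \<le> a + b" using assms degree_mult_le[of p q] by linarith
  then show ?thesis using False assms by (simp add: hom_eval_nz power_add)
qed

lemma hom_eval_linear_power: "hom_eval l ([:s, r:] ^ l) x y = (r * x + s * y) ^ l"
proof (induction l)
  case 0
  then show ?case by (simp add: hom_eval_def)
next
  case (Suc l)
  have d1: "degree [:s, r:] \<le> 1" by simp
  have d2: "degree ([:s, r:] ^ l) \<le> l"
    using degree_power_le[of "[:s, r:]" l] d1 by (metis le_trans mult_le_mono1 nat_mult_1)
  have "hom_eval (1 + l) ([:s, r:] * [:s, r:] ^ l) x y
      = hom_eval 1 [:s, r:] x y * hom_eval l ([:s, r:] ^ l) x y"
    by (rule hom_eval_mult[OF d1 d2])
  moreover have "hom_eval 1 [:s, r:] x y = r * x + s * y"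
    by (simp add: hom_eval_def)
  ultimately show ?case using Suc.IH by simp
qed

lemma degree_linear_power: "degree ([:s, r:] ^ l) \<le> l" for s r :: complex
  using degree_power_le[of "[:s, r:]" l] by (auto split: if_splits)

text \<open>The matrix describes the action by substitution.\<close>

lemma spin_mat_action:
  assumes "l \<le> n"
  shows "spin_basis n l (x * u $ 1 $ 1 + y * u $ 2 $ 1) (x * u $ 1 $ 2 + y * u $ 2 $ 2)
    = (\<Sum>k\<le>n. spin_mat n u k l * spin_basis n k x y)"
proof -
  define p where "p = [:u $ 2 $ 1, u $ 1 $ 1:] ^ l * [:u $ 2 $ 2, u $ 1 $ 2:] ^ (n - l)"
  define w :: "nat \<Rightarrow> complex" where "w k = of_real (sqrt (fact k * fact (n - k)))" for k
  have w: "w k \<noteq> 0" for k by (simp add: w_def)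
  have "hom_eval (l + (n - l)) p x y
      = hom_eval l ([:u $ 2 $ 1, u $ 1 $ 1:] ^ l) x y
        * hom_eval (n - l) ([:u $ 2 $ 2, u $ 1 $ 2:] ^ (n - l)) x y"
    unfolding p_def by (rule hom_eval_mult) (rule degree_linear_power)+
  then have "hom_eval n p x y = (x * u $ 1 $ 1 + y * u $ 2 $ 1) ^ l
      * (x * u $ 1 $ 2 + y * u $ 2 $ 2) ^ (n - l)"
    using assms by (simp add: hom_eval_linear_power mult.commute)
  then have "spin_basis n l (x * u $ 1 $ 1 + y * u $ 2 $ 1) (x * u $ 1 $ 2 + y * u $ 2 $ 2)
      = hom_eval n p x y / w l"
    by (simp add: spin_basis_def w_def)
  also have "\<dots> = (\<Sum>k\<le>n. (w k / w l * coeff p k) * (x ^ k * y ^ (n - k) / w k))"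
    unfolding hom_eval_def sum_divide_distrib by (intro sum.cong) (use w in auto)
  finally show ?thesis
    by (simp add: spin_mat_def spin_basis_def p_def w_def)
qed

lemma spin_basis_independent:
  assumes "\<And>x. (\<Sum>k\<le>n. a k * spin_basis n k x 1) = (\<Sum>k\<le>n. b k * spin_basis n k x 1)" "k \<le> n"
  shows "a k = b k"
proof -
  define w :: "nat \<Rightarrow> complex" where "w k = of_real (sqrt (fact k * fact (n - k)))" for k
  have w: "w k \<noteq> 0" by (simp add: w_def)
  have "\<forall>x. (\<Sum>k\<le>n. (a k / w k) * x ^ k) = (\<Sum>k\<le>n. (b k / w k) * x ^ k)"
    using assms(1) by (simp add: spin_basis_def w_def)
  then have "\<forall>k\<le>n. a k / w k = b k / w k"
    by (simp only: polyfun_eq_coeffs)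
  then show ?thesis using assms(2) w by auto
qed

lemma spin_mat_mult:
  assumes "k \<le> n" "l \<le> n"
  shows "spin_mat n (u ** v) k l = (\<Sum>m\<le>n. spin_mat n u k m * spin_mat n v m l)"
proof (rule spin_basis_independent[OF _ assms(1)])
  fix x :: complex
  let ?X = "x * u $ 1 $ 1 + 1 * u $ 2 $ 1" and ?Y = "x * u $ 1 $ 2 + 1 * u $ 2 $ 2"
  have "(\<Sum>k\<le>n. spin_mat n (u ** v) k l * spin_basis n k x 1)
      = spin_basis n l (x * (u ** v) $ 1 $ 1 + 1 * (u ** v) $ 2 $ 1)
          (x * (u ** v) $ 1 $ 2 + 1 * (u ** v) $ 2 $ 2)"
    by (rule spin_mat_action[OF assms(2), symmetric])
  also have "\<dots> = spin_basis n l (?X * v $ 1 $ 1 + ?Y * v $ 2 $ 1) (?X * v $ 1 $ 2 + ?Y * v $ 2 $ 2)"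
    by (simp add: matrix_matrix_mult_def sum_2 algebra_simps)
  also have "\<dots> = (\<Sum>m\<le>n. spin_mat n v m l * spin_basis n m ?X ?Y)"
    by (rule spin_mat_action[OF assms(2)])
  also have "\<dots> = (\<Sum>m\<le>n. spin_mat n v m l * (\<Sum>k\<le>n. spin_mat n u k m * spin_basis n k x 1))"
    by (intro sum.cong refl arg_cong2[where f = "(*)"] spin_mat_action) simp
  also have "\<dots> = (\<Sum>k\<le>n. (\<Sum>m\<le>n. spin_mat n u k m * spin_mat n v m l) * spin_basis n k x 1)"
    unfolding sum_distrib_left sum_distrib_right
    by (subst sum.swap) (simp add: mult_ac)
  finally show "(\<Sum>k\<le>n. spin_mat n (u ** v) k l * spin_basis n k x 1) = \<dots>" .
qed

lemma spin_mat_one: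
  assumes "k \<le> n" "l \<le> n"
  shows "spin_mat n (mat 1) k l = (if k = l then 1 else 0)"
proof (rule spin_basis_independent[OF _ assms(1)])
  fix x :: complex
  have "(\<Sum>k\<le>n. spin_mat n (mat 1) k l * spin_basis n k x 1) = spin_basis n l x 1"
    using spin_mat_action[OF assms(2), of x "mat 1" 1] by (simp add: mat_def)
  also have "\<dots> = (\<Sum>k\<le>n. (if k = l then 1 else 0) * spin_basis n k x 1)"
    using assms(2) by (simp add: if_distrib[of "\<lambda>z. z * _"] cong: if_cong)
  finally show "(\<Sum>k\<le>n. spin_mat n (mat 1) k l * spin_basis n k x 1) = \<dots>" .
qed

lemma spin_basis_kernel:
  "(\<Sum>k\<le>n. spin_basis n k x y * spin_basis n k x' y') = (x * x' + y * y') ^ n / fact n"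
proof -
  have w: "of_real (sqrt (fact k * fact (n - k))) * of_real (sqrt (fact k * fact (n - k)))
      = (fact k * fact (n - k) :: complex)" for k
  proof -
    have "sqrt (fact k * fact (n - k)) * sqrt (fact k * fact (n - k)) = fact k * fact (n - k)"
      by (rule real_sqrt_mult_self[THEN trans]) simp
    then have "of_real (sqrt (fact k * fact (n - k)) * sqrt (fact k * fact (n - k)))
        = (of_real (fact k * fact (n - k)) :: complex)"
      by (rule arg_cong)
    then show ?thesis by (simp only: of_real_mult of_real_fact)
  qed
  have "(x * x' + y * y') ^ n / fact n
      = (\<Sum>k\<le>n. of_nat (n choose k) * (x * x') ^ k * (y * y') ^ (n - k) / fact n)"
    by (simp add: binomial_ring sum_divide_distrib)
  also have "\<dots> = (\<Sum>k\<le>n. spin_basis n k x y * spin_basis n k x' y')"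
  proof (rule sum.cong[OF refl])
    fix k assume "k \<in> {..n}"
    then have "of_nat (n choose k) = (fact n / (fact k * fact (n - k)) :: complex)"
      by (simp add: binomial_fact)
    then show "of_nat (n choose k) * (x * x') ^ k * (y * y') ^ (n - k) / fact n
        = spin_basis n k x y * spin_basis n k x' y'"
      by (simp only: spin_basis_def times_divide_times_eq w) (simp add: power_mult_distrib)
  qed
  finally show ?thesis by simp
qed

lemma spin_mat_transpose:
  assumes "k \<le> n" "l \<le> n"
  shows "spin_mat n (transpose u) k l = spin_mat n u l k"
proof -
  have "(\<Sum>l\<le>n. spin_mat n u k l * spin_basis n l x' 1)
      = (\<Sum>l\<le>n. spin_mat n (transpose u) l k * spin_basis n l x' 1)" if "k \<le> n" for k x'
  proof (rule spin_basis_independent[OF _ that])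
    fix x :: complex
    let ?X = "x * u $ 1 $ 1 + 1 * u $ 2 $ 1" and ?Y = "x * u $ 1 $ 2 + 1 * u $ 2 $ 2"
    let ?u = "transpose u"
    let ?X' = "x' * ?u $ 1 $ 1 + 1 * ?u $ 2 $ 1" and ?Y' = "x' * ?u $ 1 $ 2 + 1 * ?u $ 2 $ 2"
    have "(\<Sum>k\<le>n. (\<Sum>l\<le>n. spin_mat n u k l * spin_basis n l x' 1) * spin_basis n k x 1)
        = (\<Sum>l\<le>n. (\<Sum>k\<le>n. spin_mat n u k l * spin_basis n k x 1) * spin_basis n l x' 1)"
      unfolding sum_distrib_right by (subst sum.swap) (simp add: mult_ac)
    also have "\<dots> = (\<Sum>l\<le>n. spin_basis n l ?X ?Y * spin_basis n l x' 1)"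
      by (intro sum.cong refl arg_cong2[where f = "(*)"] spin_mat_action[symmetric]) simp
    also have "\<dots> = (?X * x' + ?Y * 1) ^ n / fact n" by (rule spin_basis_kernel)
    also have "\<dots> = (?X' * x + ?Y' * 1) ^ n / fact n"
      by (simp add: transpose_def algebra_simps)
    also have "\<dots> = (\<Sum>k\<le>n. spin_basis n k ?X' ?Y' * spin_basis n k x 1)"
      by (rule spin_basis_kernel[symmetric])
    also have "\<dots> = (\<Sum>k\<le>n. (\<Sum>l\<le>n. spin_mat n ?u l k * spin_basis n l x' 1) * spin_basis n k x 1)"
      by (intro sum.cong refl arg_cong2[where f = "(*)"] spin_mat_action) simp
    finally show "(\<Sum>k\<le>n. (\<Sum>l\<le>n. spin_mat n u k l * spin_basis n l x' 1) * spin_basis n k x 1) = \<dots>" .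
  qed
  from spin_basis_independent[OF this[OF assms(2)] assms(1)] show ?thesis by simp
qed

lemma spin_mat_cnj: "spin_mat n (\<chi> i k. cnj (u $ i $ k)) k l = cnj (spin_mat n u k l)"
proof -
  have pCons: "map_poly cnj [:a, b:] = [:cnj a, cnj b:]" for a b
    by (simp add: map_poly_pCons)
  have mult: "map_poly cnj (p * q) = map_poly cnj p * map_poly cnj q" for p q
    by (simp add: poly_eq_iff coeff_map_poly coeff_mult)
  have power: "map_poly cnj (p ^ m) = map_poly cnj p ^ m" for p m
    by (induction m) (simp_all add: mult map_poly_1)
  have "cnj (coeff ([:u $ 2 $ 1, u $ 1 $ 1:] ^ l * [:u $ 2 $ 2, u $ 1 $ 2:] ^ (n - l)) k)
      = coeff (map_poly cnj ([:u $ 2 $ 1, u $ 1 $ 1:] ^ l * [:u $ 2 $ 2, u $ 1 $ 2:] ^ (n - l))) k"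
    by (simp add: coeff_map_poly)
  then show ?thesis by (simp add: spin_mat_def mult power pCons)
qed

lemma spin_mat_unitary:
  assumes "u \<in> SU2" "k \<le> n" "l \<le> n"
  shows "(\<Sum>m\<le>n. spin_mat n u k m * cnj (spin_mat n u l m)) = (if k = l then 1 else 0)"
proof -
  let ?c = "\<chi> i k. cnj (u $ i $ k)"
  have t: "(\<chi> i k. cnj (u $ k $ i)) = transpose ?c" by (simp add: transpose_def vec_eq_iff)
  have "(\<Sum>m\<le>n. spin_mat n u k m * cnj (spin_mat n u l m))
      = (\<Sum>m\<le>n. spin_mat n u k m * spin_mat n (transpose ?c) m l)"
    using assms(3) by (intro sum.cong refl) (simp add: spin_mat_transpose spin_mat_cnj)
  also have "\<dots> = spin_mat n (u ** transpose ?c) k l"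
    by (rule spin_mat_mult[OF assms(2,3), symmetric])
  also have "\<dots> = spin_mat n (mat 1) k l"
    using assms(1) by (simp add: SU2_def t)
  finally show ?thesis by (simp add: spin_mat_one[OF assms(2,3)])
qed


subsection \<open>Tensors and the group algebra\<close>

lemma finite_multi_indices [simp]: "finite (multi_indices n N)"
  unfolding multi_indices_def by (intro finite_PiE) auto

lemma finite_Sym [simp]: "finite (Sym N)"
  unfolding Sym_def by (rule finite_permutations) simp

lemma tensor_rep_pure:
  "tensor_rep n N u (pure_tensor n N v) = pure_tensor n N (\<lambda>i. spin_rep n u (v i))"
proof
  fix m
  show "tensor_rep n N u (pure_tensor n N v) m = pure_tensor n N (\<lambda>i. spin_rep n u (v i)) m"
  proof (cases "m \<in> multi_indices n N")
    case True
    then have le: "m i \<le> n" if "i \<in> {1..N}" for i using that by (auto simp: multi_indices_def)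
    have "(\<Prod>i\<in>{1..N}. spin_rep n u (v i) (m i))
        = (\<Prod>i\<in>{1..N}. \<Sum>l\<in>{..n}. spin_mat n u (m i) l * v i l)"
      by (intro prod.cong refl) (simp add: spin_rep_def le)
    also have "\<dots> = (\<Sum>m'\<in>multi_indices n N. \<Prod>i\<in>{1..N}. spin_mat n u (m i) (m' i) * v i (m' i))"
      unfolding multi_indices_def by (rule prod_sum_PiE) auto
    finally show ?thesis
      using True by (simp add: tensor_rep_def pure_tensor_def prod.distrib)
  qed (simp add: tensor_rep_def pure_tensor_def)
qed

lemma comp_inv_multi_indices:
  assumes "\<sigma> \<in> Sym N"
  shows "m \<circ> inv \<sigma> \<in> multi_indices n N \<longleftrightarrow> m \<in> multi_indices n N"
proof -
  have *: "m \<circ> \<tau> \<in> multi_indices n N" if "\<tau> permutes {1..N}" "m \<in> multi_indices n N" for \<tau> m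
    using that permutes_in_image[OF that(1)] permutes_not_in[OF that(1)]
    by (fastforce simp: multi_indices_def PiE_iff extensional_def)
  have s: "\<sigma> permutes {1..N}" using assms by (simp add: Sym_def)
  show ?thesis
    using *[OF permutes_inv[OF s], of m] *[OF s, of "m \<circ> inv \<sigma>"]
    by (auto simp: comp_assoc permutes_inv_o[OF s])
qed

lemma perm_act_pure:
  assumes "\<sigma> \<in> Sym N"
  shows "perm_act (pure_tensor n N v) \<sigma> = pure_tensor n N (\<lambda>i. v (\<sigma> i))"
proof
  fix m
  have s: "\<sigma> permutes {1..N}" using assms by (simp add: Sym_def)
  have "(\<Prod>i\<in>{1..N}. v i (m (inv \<sigma> i))) = (\<Prod>i\<in>{1..N}. v (\<sigma> i) (m i))"
    by (subst prod.permute[OF s]) (simp add: permutes_inverses[OF s])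
  then show "perm_act (pure_tensor n N v) \<sigma> m = pure_tensor n N (\<lambda>i. v (\<sigma> i)) m"
    by (simp add: perm_act_def pure_tensor_def comp_inv_multi_indices[OF assms])
qed

lemma pure_tensors_span: "tensors n N = cfun.span (range (pure_tensor n N))"
proof
  show "cfun.span (range (pure_tensor n N)) \<subseteq> tensors n N"
    by (rule cfun.span_minimal)
      (auto simp: cfun.subspace_def tensors_def pure_tensor_def cscale_def)
  show "tensors n N \<subseteq> cfun.span (range (pure_tensor n N))"
  proof
    fix t assume t: "t \<in> tensors n N"
    define e where "e m' = pure_tensor n N (\<lambda>i k. if k = m' i then 1 else 0)" for m'
    have e: "e m' m = (if m = m' then 1 else 0)"
      if m: "m \<in> multi_indices n N" "m' \<in> multi_indices n N" for m m'
    proof (cases "m = m'")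
      case False
      have "m = m'" if "\<forall>i\<in>{1..N}. m i = m' i"
        by (rule PiE_ext[OF m[unfolded multi_indices_def]]) (use that in blast)
      then obtain i where "i \<in> {1..N}" "m i \<noteq> m' i"
        using False by blast
      then have "(\<Prod>i\<in>{1..N}. if m i = m' i then 1 else 0 :: complex) = 0"
        by (intro prod_zero) auto
      then show ?thesis using False by (simp add: e_def pure_tensor_def)
    qed (simp add: e_def pure_tensor_def m)
    have "t = (\<Sum>m'\<in>multi_indices n N. cscale (t m') (e m'))"
    proof
      fix m
      show "t m = (\<Sum>m'\<in>multi_indices n N. cscale (t m') (e m')) m"
      proof (cases "m \<in> multi_indices n N")
        case True
        then have "(\<Sum>m'\<in>multi_indices n N. t m' * e m' m)
            = (\<Sum>m'\<in>multi_indices n N. if m = m' then t m' else 0)"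
          by (intro sum.cong refl) (simp add: e)
        then show ?thesis using True by (simp add: sum_fun_apply cscale_def)
      next
        case False
        then show ?thesis using t
          by (simp add: sum_fun_apply cscale_def e_def pure_tensor_def tensors_def)
      qed
    qed
    also have "\<dots> \<in> cfun.span (range (pure_tensor n N))"
      unfolding e_def by (intro cfun.span_sum cfun.span_scale cfun.span_base) auto
    finally show "t \<in> cfun.span (range (pure_tensor n N))" .
  qed
qed

lemma perm_act_linear:
  "perm_act (s + t) \<sigma> = perm_act s \<sigma> + perm_act t \<sigma>"
  "perm_act (cscale c t) \<sigma> = cscale c (perm_act t \<sigma>)"
  by (simp_all add: perm_act_def cscale_def fun_eq_iff)

lemma perm_act_comp:
  assumes "\<sigma> \<in> Sym N" "\<tau> \<in> Sym N"
  shows "perm_act (perm_act t \<sigma>) \<tau> = perm_act t (\<sigma> \<circ> \<tau>)"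
proof -
  have "bij \<sigma>" "bij \<tau>" using assms by (auto simp: Sym_def permutes_bij)
  then show ?thesis by (simp add: perm_act_def o_inv_distrib comp_assoc)
qed

end

theory Submission
  imports Defs "HOL-Library.Fun_Lexorder"
begin

text \<open>Order the standard tableaux with \<open>N\<close> boxes, of all shapes, by their first difference in
  row reading. If \<open>S < T\<close>, two numbers lie in the same row of \<open>S\<close> and the same column of \<open>T\<close>, so
  \<open>c\<^sub>T c\<^sub>S = 0\<close>. Moreover \<open>y c\<^sub>T c\<^sub>T = 0\<close> implies \<open>y c\<^sub>T = 0\<close>, by positivity of \<open>y y\<^sup>*\<close>. Multiplying by
  extremal symmetrizers shows that the blocks \<open>c\<^sub>S A \<inter> A c\<^sub>T\<close> of the group algebra \<open>A\<close> are
  independent. Blocks of equal shape are non-zero, and there are \<open>\<Sum>\<^sub>\<lambda> f\<^sub>\<lambda>\<^sup>2 = N!\<close> of them, so they are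
  lines spanning \<open>A\<close>. Hence \<open>c\<^sub>T A c\<^sub>T = \<complex> c\<^sub>T\<close> and \<open>1 \<in> \<Sum>\<^sub>T A c\<^sub>T\<close>, and both parts of the decomposition
  hold for every space \<open>V\<close> of tensors stable under permutations: \<open>V = \<Oplus>\<^sub>T V c\<^sub>T\<close>, and averaging a rank one
  map over the group yields an element of the commutant taking a given non-zero vector of \<open>V c\<^sub>T\<close> to any
  other.\<close>

section \<open>The group algebra\<close>

text \<open>Symmetrizers of different standard tableaux of one shape need not be orthogonal: their
  product is known to vanish in one order only. A direct sum can therefore not be read off from
  orthogonal idempotents, and triangularity takes their place: a vanishing sum is multiplied by the
  symmetrizer of an extremal index among its non-zero terms, which isolates one term, and the
  cancellation law then removes the multiplier. Cancellation cannot be taken from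
  \<open>c c = \<kappa> c\<close> with \<open>\<kappa> \<noteq> 0\<close>, since that is one of the
  results. Positivity supplies it, with the obstacle that \<open>c = a b\<close> is not
  self-adjoint; its two factors are. Two-sided blocks are used because they can be counted without
  knowing the dimension of any ideal \<open>A c\<close>: pairs of standard tableaux of equal shape
  are compared with the dimension of the whole algebra. The count itself comes from Young's lattice,
  where "up after down" and "down after up" differ by the identity. The factor dim V_lambda / N! is
  a non-zero scalar, so \<open>e\<close> and \<open>c\<close> have the same image and all arguments
  are made for \<open>c\<close>.\<close>

lemma Sym_comp: "\<sigma> \<in> Sym N \<Longrightarrow> \<tau> \<in> Sym N \<Longrightarrow> \<sigma> \<circ> \<tau> \<in> Sym N"
  by (simp add: Sym_def permutes_compose)

lemma Sym_inv: "\<sigma> \<in> Sym N \<Longrightarrow> inv \<sigma> \<in> Sym N"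
  by (simp add: Sym_def permutes_inv)

lemma Sym_id [simp]: "id \<in> Sym N"
  by (simp add: Sym_def permutes_id)

lemma Sym_inv_o [simp]:
  assumes "\<sigma> \<in> Sym N"
  shows "inv \<sigma> \<circ> \<sigma> = id" "\<sigma> \<circ> inv \<sigma> = id" "inv (inv \<sigma>) = \<sigma>"
  using assms by (auto simp: Sym_def permutes_inv_o permutes_inv_inv)

lemma Sym_cancel [simp]:
  assumes "\<sigma> \<in> Sym N"
  shows "inv \<sigma> \<circ> (\<sigma> \<circ> \<tau>) = \<tau>" "\<sigma> \<circ> (inv \<sigma> \<circ> \<tau>) = \<tau>"
    "\<tau> \<circ> inv \<sigma> \<circ> \<sigma> = \<tau>" "\<tau> \<circ> \<sigma> \<circ> inv \<sigma> = \<tau>"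
proof -
  show "inv \<sigma> \<circ> (\<sigma> \<circ> \<tau>) = \<tau>" "\<sigma> \<circ> (inv \<sigma> \<circ> \<tau>) = \<tau>"
    unfolding comp_assoc[symmetric] Sym_inv_o[OF assms] by simp_all
  show "\<tau> \<circ> inv \<sigma> \<circ> \<sigma> = \<tau>" "\<tau> \<circ> \<sigma> \<circ> inv \<sigma> = \<tau>"
    unfolding comp_assoc Sym_inv_o[OF assms] by simp_all
qed

lemma Sym_inv_comp:
  "\<sigma> \<in> Sym N \<Longrightarrow> \<tau> \<in> Sym N \<Longrightarrow> inv (\<sigma> \<circ> \<tau>) = inv \<tau> \<circ> inv \<sigma>"
  by (intro o_inv_distrib) (auto simp: Sym_def permutes_bij)

lemma Sym_comp_iff:
  assumes "\<sigma> \<in> Sym N"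
  shows "\<sigma> \<circ> \<tau> \<in> Sym N \<longleftrightarrow> \<tau> \<in> Sym N" "\<tau> \<circ> \<sigma> \<in> Sym N \<longleftrightarrow> \<tau> \<in> Sym N"
proof -
  have "\<tau> \<in> Sym N" if "\<sigma> \<circ> \<tau> \<in> Sym N"
    using Sym_comp[OF Sym_inv[OF assms] that] unfolding Sym_cancel[OF assms] .
  moreover have "\<tau> \<in> Sym N" if "\<tau> \<circ> \<sigma> \<in> Sym N"
    using Sym_comp[OF that Sym_inv[OF assms]] unfolding Sym_cancel[OF assms] .
  ultimately show "\<sigma> \<circ> \<tau> \<in> Sym N \<longleftrightarrow> \<tau> \<in> Sym N" "\<tau> \<circ> \<sigma> \<in> Sym N \<longleftrightarrow> \<tau> \<in> Sym N"
    using assms Sym_comp by blast+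
qed

lemma Sym_sum_left: "\<sigma> \<in> Sym N \<Longrightarrow> (\<Sum>\<tau>\<in>Sym N. f (\<sigma> \<circ> \<tau>)) = (\<Sum>\<tau>\<in>Sym N. f \<tau>)"
  using setum_permutations_compose_left[of \<sigma> "{1..N}" f] by (simp add: Sym_def)

lemma Sym_sum_inv: "(\<Sum>\<tau>\<in>Sym N. f (inv \<tau>)) = (\<Sum>\<tau>\<in>Sym N. f \<tau>)"
  using sum_permutations_inverse[of f "{1..N}"] by (simp add: Sym_def)

lemma sign_Sym:
  assumes "\<sigma> \<in> Sym N" "\<tau> \<in> Sym N"
  shows "sign (\<sigma> \<circ> \<tau>) = sign \<sigma> * sign \<tau>" "sign (inv \<sigma>) = sign \<sigma>"
proof -
  have "permutation \<sigma>" "permutation \<tau>"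
    using assms by (auto simp: Sym_def intro: permutation_permutes[THEN iffD2] finite_atLeastAtMost)
  then show "sign (\<sigma> \<circ> \<tau>) = sign \<sigma> * sign \<tau>" "sign (inv \<sigma>) = sign \<sigma>"
    by (auto simp: sign_compose sign_inverse)
qed

lemma cscale_simps:
  "cscale c (x + y) = cscale c x + cscale c y"
  "cscale (c + d) x = cscale c x + cscale d x"
  "cscale c (cscale d x) = cscale (c * d) x"
  "cscale 1 x = x" "cscale 0 x = 0" "cscale c 0 = 0"
  by (auto simp: cscale_def fun_eq_iff algebra_simps)

lemma cscale_eq_0_iff: "cscale c x = 0 \<longleftrightarrow> c = 0 \<or> x = 0"
  by (auto simp: cscale_def fun_eq_iff)

section \<open>The right action and the algebra structure\<close>

lemma ga_act_apply: "ga_act N t a m = (\<Sum>g\<in>Sym N. a g * t (m \<circ> inv g))"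
  by (simp add: ga_act_def sum_fun_apply cscale_def perm_act_def)

lemma ga_act_add_left: "ga_act N (s + t) a = ga_act N s a + ga_act N t a"
  by (simp add: fun_eq_iff ga_act_apply algebra_simps sum.distrib)

lemma ga_act_scale_left: "ga_act N (cscale c t) a = cscale c (ga_act N t a)"
  by (simp add: fun_eq_iff ga_act_apply cscale_def sum_distrib_left mult_ac)

lemma ga_act_scale_right: "ga_act N t (cscale c a) = cscale c (ga_act N t a)"
  by (simp add: fun_eq_iff ga_act_apply cscale_def sum_distrib_left mult_ac)

lemma ga_act_zero [simp]: "ga_act N 0 a = 0" "ga_act N t 0 = 0"
  by (simp_all add: fun_eq_iff ga_act_apply)

lemma ga_act_sum_left: "ga_act N (\<Sum>i\<in>I. f i) a = (\<Sum>i\<in>I. ga_act N (f i) a)"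
  unfolding fun_eq_iff ga_act_apply sum_fun_apply sum_distrib_left
  by (intro allI sum.swap)

lemma ga_act_sum_right: "ga_act N t (\<Sum>i\<in>I. f i) = (\<Sum>i\<in>I. ga_act N t (f i))"
  unfolding fun_eq_iff ga_act_apply sum_fun_apply sum_distrib_right
  by (intro allI sum.swap)

lemma ga_act_basis:
  assumes "g \<in> Sym N"
  shows "ga_act N t (ga_basis g) = perm_act t g"
proof
  fix m
  have "ga_act N t (ga_basis g) m = (\<Sum>h\<in>Sym N. if h = g then t (m \<circ> inv h) else 0)"
    unfolding ga_act_apply ga_basis_def by (intro sum.cong) auto
  then show "ga_act N t (ga_basis g) m = perm_act t g m"
    using assms by (simp add: perm_act_def)
qed

lemma ga_act_mult: "ga_act N t (ga_mult N a b) = ga_act N (ga_act N t a) b"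
proof -
  have "ga_act N t (ga_mult N a b)
      = (\<Sum>g\<in>Sym N. \<Sum>h\<in>Sym N. cscale (a g * b h) (perm_act t (g \<circ> h)))"
    by (simp add: ga_mult_def ga_act_sum_right ga_act_scale_right ga_act_basis Sym_comp)
  also have "\<dots> = (\<Sum>h\<in>Sym N. cscale (b h) (perm_act (\<Sum>g\<in>Sym N. cscale (a g) (perm_act t g)) h))"
  proof (subst sum.swap, rule sum.cong[OF refl])
    fix h assume h: "h \<in> Sym N"
    have s: "perm_act (\<Sum>g\<in>G. f g) h = (\<Sum>g\<in>G. perm_act (f g) h)"
      for f :: "_ \<Rightarrow> (nat \<Rightarrow> nat) \<Rightarrow> complex" and G
      by (simp add: fun_eq_iff perm_act_def sum_fun_apply)
    show "(\<Sum>g\<in>Sym N. cscale (a g * b h) (perm_act t (g \<circ> h)))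
        = cscale (b h) (perm_act (\<Sum>g\<in>Sym N. cscale (a g) (perm_act t g)) h)"
      unfolding s cfun.scale_sum_right
      by (intro sum.cong refl) (simp add: perm_act_linear perm_act_comp h cscale_simps mult_ac)
  qed
  finally show ?thesis by (simp add: ga_act_def)
qed

lemma ga_mult_in [simp]: "ga_mult N a b \<in> group_algebra N"
  unfolding group_algebra_def ga_mult_def
  by (auto simp: sum_fun_apply cscale_def ga_basis_def intro!: sum.neutral) (metis Sym_comp)

lemma ga_basis_in [simp]: "g \<in> Sym N \<Longrightarrow> ga_basis g \<in> group_algebra N"
  by (auto simp: group_algebra_def ga_basis_def)

lemma group_algebra_subspace: "cfun.subspace (group_algebra N)"
  by (auto simp: cfun.subspace_def group_algebra_def cscale_def)

lemma ga_mult_apply: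
  assumes "k \<in> Sym N"
  shows "ga_mult N a b k = (\<Sum>g\<in>Sym N. a g * b (inv g \<circ> k))"
proof -
  have "(\<Sum>h\<in>Sym N. a g * b h * ga_basis (g \<circ> h) k) = a g * b (inv g \<circ> k)" if g: "g \<in> Sym N" for g
  proof -
    have "(\<Sum>h\<in>Sym N. a g * b h * ga_basis (g \<circ> h) k)
        = (\<Sum>h\<in>Sym N. if h = inv g \<circ> k then a g * b h else 0)"
    proof (intro sum.cong refl)
      fix h
      have "k = g \<circ> h \<longleftrightarrow> h = inv g \<circ> k" using g by auto
      then show "a g * b h * ga_basis (g \<circ> h) k = (if h = inv g \<circ> k then a g * b h else 0)"
        by (simp add: ga_basis_def)
    qed
    then show ?thesis using g assms by (simp add: Sym_comp Sym_inv)
  qed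
  then show ?thesis by (simp add: ga_mult_def sum_fun_apply cscale_def)
qed

lemma ga_eqI:
  assumes "a \<in> group_algebra N" "b \<in> group_algebra N" "\<And>g. g \<in> Sym N \<Longrightarrow> a g = b g"
  shows "a = b"
proof
  show "a g = b g" for g
    using assms by (cases "g \<in> Sym N") (auto simp: group_algebra_def)
qed

text \<open>Group elements and multi-indices are both maps on the naturals, so
  \<open>perm_act\<close> applied to an element of the algebra is right multiplication by
  \<open>e_g\<close>. The regular representation becomes an instance of the action on tensors, and
  associativity follows from \<open>ga_act_mult\<close>.\<close>

lemma ga_mult_eq_act:
  assumes "a \<in> group_algebra N"
  shows "ga_mult N a b = ga_act N a b"
proof (rule ga_eqI[OF ga_mult_in])
  show "ga_act N a b \<in> group_algebra N"
    using assms unfolding group_algebra_def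
    by (auto simp: ga_act_apply Sym_inv Sym_comp_iff intro!: sum.neutral)
  fix k assume k: "k \<in> Sym N"
  have "ga_mult N a b k = (\<Sum>g\<in>Sym N. a (k \<circ> inv g) * b (inv (k \<circ> inv g) \<circ> k))"
    unfolding ga_mult_apply[OF k]
      Sym_sum_left[OF k, of "\<lambda>g. a g * b (inv g \<circ> k)", symmetric]
      Sym_sum_inv[of "\<lambda>g. a (k \<circ> g) * b (inv (k \<circ> g) \<circ> k)", symmetric] ..
  also have "\<dots> = ga_act N a b k"
    unfolding ga_act_apply
    by (intro sum.cong refl) (simp add: Sym_inv_comp[OF k Sym_inv] Sym_cancel[OF k] comp_assoc Sym_inv_o[OF k] Sym_inv_o mult.commute)
  finally show "ga_mult N a b k = ga_act N a b k" .
qed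

lemma ga_mult_add:
  "ga_mult N (a + b) c = ga_mult N a c + ga_mult N b c"
  "ga_mult N a (b + c) = ga_mult N a b + ga_mult N a c"
  by (simp_all add: ga_mult_def cscale_simps algebra_simps sum.distrib)

lemma ga_mult_scale:
  "ga_mult N (cscale c a) b = cscale c (ga_mult N a b)"
  "ga_mult N a (cscale c b) = cscale c (ga_mult N a b)"
  by (simp_all add: ga_mult_def cfun.scale_sum_right cscale_simps, simp_all add: cscale_def mult_ac)

lemma ga_mult_zero [simp]: "ga_mult N 0 a = 0" "ga_mult N a 0 = 0"
  by (simp_all add: ga_mult_def cscale_simps)

lemma ga_mult_sum:
  "ga_mult N (\<Sum>i\<in>I. f i) a = (\<Sum>i\<in>I. ga_mult N (f i) a)"
  "ga_mult N a (\<Sum>i\<in>I. f i) = (\<Sum>i\<in>I. ga_mult N a (f i))"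
  by (induction I rule: infinite_finite_induct) (simp_all add: ga_mult_add)

lemma ga_mult_basis_left:
  assumes "h \<in> Sym N" "k \<in> Sym N"
  shows "ga_mult N (ga_basis h) a k = a (inv h \<circ> k)"
proof -
  have "ga_mult N (ga_basis h) a k = (\<Sum>g\<in>Sym N. if g = h then a (inv g \<circ> k) else 0)"
    unfolding ga_mult_apply[OF assms(2)] ga_basis_def by (intro sum.cong) auto
  then show ?thesis using assms by simp
qed

lemma ga_mult_basis_right:
  assumes "h \<in> Sym N" "k \<in> Sym N"
  shows "ga_mult N a (ga_basis h) k = a (k \<circ> inv h)"
proof -
  have "ga_mult N a (ga_basis h) k = (\<Sum>g\<in>Sym N. if g = k \<circ> inv h then a g else 0)"
    unfolding ga_mult_apply[OF assms(2)]
  proof (intro sum.cong refl)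
    fix g assume g: "g \<in> Sym N"
    have "inv g \<circ> k = h \<longleftrightarrow> g = k \<circ> inv h"
      using g assms Sym_cancel comp_assoc by metis
    then show "a g * ga_basis h (inv g \<circ> k) = (if g = k \<circ> inv h then a g else 0)"
      by (simp add: ga_basis_def)
  qed
  then show ?thesis using assms by (simp add: Sym_comp Sym_inv)
qed

lemma ga_mult_one:
  assumes "a \<in> group_algebra N"
  shows "ga_mult N (ga_basis id) a = a" "ga_mult N a (ga_basis id) = a"
  by (rule ga_eqI[OF ga_mult_in assms]; simp add: ga_mult_basis_left ga_mult_basis_right)+

lemma ga_mult_assoc: "ga_mult N (ga_mult N a b) c = ga_mult N a (ga_mult N b c)"
proof -
  \<comment> \<open>The product reads only the values on \<open>Sym N\<close>, whereas
    \<open>ga_mult_eq_act\<close> wants a left factor supported there; cutting \<open>a\<close> off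
    gives associativity for arbitrary functions.\<close>
  define a' where "a' g = (if g \<in> Sym N then a g else 0)" for g
  have a': "a' \<in> group_algebra N" "ga_mult N a d = ga_mult N a' d" for d
    by (auto simp: a'_def group_algebra_def ga_mult_def)
  show ?thesis
    unfolding a'(2)
    by (simp only: ga_mult_eq_act[OF ga_mult_in]) (simp only: ga_mult_eq_act[OF a'(1)] ga_act_mult)
qed

lemma group_algebra_expand:
  assumes "a \<in> group_algebra N"
  shows "a = (\<Sum>g\<in>Sym N. cscale (a g) (ga_basis g))"
proof
  fix k
  have "(\<Sum>g\<in>Sym N. a g * ga_basis g k) = (\<Sum>g\<in>Sym N. if g = k then a g else 0)"
    by (intro sum.cong) (auto simp: ga_basis_def)
  then show "a k = (\<Sum>g\<in>Sym N. cscale (a g) (ga_basis g)) k"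
    using assms by (auto simp: sum_fun_apply cscale_def group_algebra_def)
qed

lemma group_algebra_span: "group_algebra N = cfun.span (ga_basis ` Sym N)"
proof
  show "cfun.span (ga_basis ` Sym N) \<subseteq> group_algebra N"
    by (rule cfun.span_minimal) (auto simp: group_algebra_subspace)
  show "group_algebra N \<subseteq> cfun.span (ga_basis ` Sym N)"
  proof
    fix a assume "a \<in> group_algebra N"
    moreover have "(\<Sum>g\<in>Sym N. cscale (a g) (ga_basis g)) \<in> cfun.span (ga_basis ` Sym N)"
      by (intro cfun.span_sum cfun.span_scale cfun.span_base) auto
    ultimately show "a \<in> cfun.span (ga_basis ` Sym N)"
      using group_algebra_expand by metis
  qed
qed

subsection \<open>The involution\<close>

text \<open>The antilinear anti-automorphism with \<open>e_g\<close> sent to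
  \<open>e_(inv g)\<close>: the adjoint for the Hermitian product in which the \<open>e_g\<close>
  are orthonormal.\<close>

definition ga_star :: "nat \<Rightarrow> ((nat \<Rightarrow> nat) \<Rightarrow> complex) \<Rightarrow> (nat \<Rightarrow> nat) \<Rightarrow> complex"
  where "ga_star N a = (\<lambda>g. if g \<in> Sym N then cnj (a (inv g)) else 0)"

lemma ga_star_mult: "ga_star N (ga_mult N a b) = ga_mult N (ga_star N b) (ga_star N a)"
proof (rule ga_eqI)
  fix k assume k: "k \<in> Sym N"
  have "ga_mult N (ga_star N b) (ga_star N a) k
      = (\<Sum>g\<in>Sym N. ga_star N b (k \<circ> g) * ga_star N a (inv (k \<circ> g) \<circ> k))"
    unfolding ga_mult_apply[OF k] Sym_sum_left[OF k, of "\<lambda>g. ga_star N b g * ga_star N a (inv g \<circ> k)"] ..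
  also have "\<dots> = (\<Sum>g\<in>Sym N. cnj (a g) * cnj (b (inv g \<circ> inv k)))"
    by (intro sum.cong refl) (simp add: ga_star_def k Sym_comp Sym_inv Sym_inv_comp Sym_inv_comp[OF k] comp_assoc Sym_inv_o[OF k] mult.commute)
  also have "\<dots> = ga_star N (ga_mult N a b) k"
    by (simp add: ga_star_def k ga_mult_apply Sym_inv)
  finally show "ga_star N (ga_mult N a b) k = ga_mult N (ga_star N b) (ga_star N a) k" ..
qed (simp_all, simp add: group_algebra_def ga_star_def)

lemma ga_star_star: "a \<in> group_algebra N \<Longrightarrow> ga_star N (ga_star N a) = a"
  by (auto simp: fun_eq_iff ga_star_def group_algebra_def Sym_inv)

lemma ga_star_zero [simp]: "ga_star N 0 = 0"
  by (simp add: fun_eq_iff ga_star_def)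

text \<open>The coefficient of \<open>a\<close> times its adjoint at the identity is the sum of the
  squared moduli of the coefficients of \<open>a\<close>.\<close>

lemma ga_star_positive:
  assumes "a \<in> group_algebra N" "ga_mult N a (ga_star N a) = 0"
  shows "a = 0"
proof -
  have "(\<Sum>g\<in>Sym N. complex_of_real ((cmod (a g))\<^sup>2)) = ga_mult N a (ga_star N a) id"
    unfolding ga_mult_apply[OF Sym_id]
    by (intro sum.cong refl) (simp add: ga_star_def Sym_inv flip: complex_norm_square)
  also have "\<dots> = 0" using assms(2) by simp
  finally have "complex_of_real (\<Sum>g\<in>Sym N. (cmod (a g))\<^sup>2) = 0" by simp
  then have "(\<Sum>g\<in>Sym N. (cmod (a g))\<^sup>2) = 0" by (simp only: of_real_eq_0_iff)
  then have "\<forall>g\<in>Sym N. a g = 0" by (simp add: sum_nonneg_eq_0_iff)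
  then show ?thesis using assms(1) by (intro ga_eqI[of _ N]) (auto simp: group_algebra_def)
qed

lemma ga_star_positive':
  assumes "a \<in> group_algebra N" "ga_mult N (ga_star N a) a = 0"
  shows "a = 0"
proof -
  have "ga_star N a = 0"
    by (rule ga_star_positive[of _ N])
      (use assms in \<open>auto simp: ga_star_star, auto simp: ga_star_def group_algebra_def\<close>)
  then show ?thesis using ga_star_star[OF assms(1)] by simp
qed

subsection \<open>Signed sums over subgroups\<close>

text \<open>Treats both factors of a Young symmetrizer at once: \<open>\<eta> = 1\<close> for the
  row group, \<open>\<eta> = sign\<close> for the column group.\<close>

definition group_sum :: "((nat \<Rightarrow> nat) \<Rightarrow> int) \<Rightarrow> (nat \<Rightarrow> nat) set \<Rightarrow> (nat \<Rightarrow> nat) \<Rightarrow> complex"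
  where "group_sum \<eta> G = (\<lambda>g. if g \<in> G then of_int (\<eta> g) else 0)"

lemma group_sum_eq:
  assumes "finite G"
  shows "(\<Sum>g\<in>G. cscale (of_int (\<eta> g)) (ga_basis g)) = group_sum \<eta> G"
proof
  fix k
  have "(\<Sum>g\<in>G. of_int (\<eta> g) * ga_basis g k) = (\<Sum>g\<in>G. if g = k then of_int (\<eta> g) else (0::complex))"
    by (intro sum.cong) (auto simp: ga_basis_def)
  then show "(\<Sum>g\<in>G. cscale (of_int (\<eta> g)) (ga_basis g)) k = group_sum \<eta> G k"
    using assms by (simp add: sum_fun_apply cscale_def group_sum_def)
qed

text \<open>The values of \<open>\<eta>\<close> on \<open>G\<close> are signs, so
  \<open>\<eta>\<close> agrees on \<open>g\<close> and its inverse and the sum over \<open>G\<close>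
  is self-adjoint. It is also its own square up to the factor \<open>card G\<close>.\<close>

locale signed_subgroup =
  fixes N :: nat and \<eta> :: "(nat \<Rightarrow> nat) \<Rightarrow> int" and G :: "(nat \<Rightarrow> nat) set"
  assumes sub: "G \<subseteq> Sym N" and id_in: "id \<in> G"
    and comp_in: "\<And>g h. g \<in> G \<Longrightarrow> h \<in> G \<Longrightarrow> g \<circ> h \<in> G"
    and inv_in: "\<And>g. g \<in> G \<Longrightarrow> inv g \<in> G"
    and char_comp: "\<And>g h. g \<in> G \<Longrightarrow> h \<in> G \<Longrightarrow> \<eta> (g \<circ> h) = \<eta> g * \<eta> h"
    and char_sq: "\<And>g. g \<in> G \<Longrightarrow> \<eta> g * \<eta> g = 1"
begin

lemma fin: "finite G"
  using finite_subset[OF sub] by simp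

lemma char_inv:
  assumes "g \<in> G"
  shows "\<eta> (inv g) = \<eta> g"
proof -
  have id1: "\<eta> id = 1"
    using char_comp[OF id_in id_in] char_sq[OF id_in] by simp
  have "\<eta> g * \<eta> (inv g) = 1"
    using char_comp[OF assms inv_in[OF assms]] Sym_inv_o(2)[OF subsetD[OF sub assms]] by (simp add: id1)
  then have "\<eta> g * (\<eta> g * \<eta> (inv g)) = \<eta> g" by simp
  then show ?thesis using char_sq[OF assms] by (simp flip: mult.assoc)
qed

lemma sum_in: "group_sum \<eta> G \<in> group_algebra N"
  using sub by (auto simp: group_sum_def group_algebra_def)

lemma basis_mult_sum:
  assumes "h \<in> G"
  shows "ga_mult N (ga_basis h) (group_sum \<eta> G) = cscale (of_int (\<eta> h)) (group_sum \<eta> G)"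
proof (rule ga_eqI[of _ N])
  fix k assume k: "k \<in> Sym N"
  have h: "h \<in> Sym N" using assms sub by auto
  have "inv h \<circ> k \<in> G \<longleftrightarrow> k \<in> G"
    using comp_in[OF inv_in[OF assms]] comp_in[OF assms, of "inv h \<circ> k"]
    by (auto simp: Sym_cancel[OF h])
  then show "ga_mult N (ga_basis h) (group_sum \<eta> G) k = cscale (of_int (\<eta> h)) (group_sum \<eta> G) k"
    using h k assms
    by (auto simp: ga_mult_basis_left cscale_def group_sum_def char_comp inv_in char_inv)
qed (use sum_in in \<open>auto intro: group_algebra_subspace cfun.subspace_scale\<close>)

lemma sum_mult_basis:
  assumes "h \<in> G"
  shows "ga_mult N (group_sum \<eta> G) (ga_basis h) = cscale (of_int (\<eta> h)) (group_sum \<eta> G)"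
proof (rule ga_eqI[of _ N])
  fix k assume k: "k \<in> Sym N"
  have h: "h \<in> Sym N" using assms sub by auto
  have "k \<circ> inv h \<in> G \<longleftrightarrow> k \<in> G"
    using comp_in[OF _ inv_in[OF assms]] comp_in[OF _ assms, of "k \<circ> inv h"]
    by (auto simp: Sym_cancel[OF h])
  then show "ga_mult N (group_sum \<eta> G) (ga_basis h) k = cscale (of_int (\<eta> h)) (group_sum \<eta> G) k"
    using h k assms
    by (auto simp: ga_mult_basis_right cscale_def group_sum_def char_comp inv_in char_inv)
qed (use sum_in in \<open>auto intro: group_algebra_subspace cfun.subspace_scale\<close>)

lemma sum_mult_sum:
  "ga_mult N (group_sum \<eta> G) (group_sum \<eta> G) = cscale (of_nat (card G)) (group_sum \<eta> G)"
proof -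
  have "ga_mult N (group_sum \<eta> G) (group_sum \<eta> G)
      = ga_mult N (\<Sum>g\<in>G. cscale (of_int (\<eta> g)) (ga_basis g)) (group_sum \<eta> G)"
    by (simp only: group_sum_eq[OF fin])
  also have "\<dots> = (\<Sum>g\<in>G. group_sum \<eta> G)"
    unfolding ga_mult_sum
    by (intro sum.cong refl)
      (simp add: ga_mult_scale basis_mult_sum cscale_simps char_sq flip: of_int_mult)
  also have "\<dots> = cscale (of_nat (card G)) (group_sum \<eta> G)"
    by (simp add: fun_eq_iff sum_fun_apply cscale_def)
  finally show ?thesis .
qed

lemma star_sum: "ga_star N (group_sum \<eta> G) = group_sum \<eta> G"
proof
  fix g
  have "inv g \<in> G \<longleftrightarrow> g \<in> G" if "g \<in> Sym N"
    using inv_in[of g] inv_in[of "inv g"] that by auto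
  then show "ga_star N (group_sum \<eta> G) g = group_sum \<eta> G g"
    using sub by (auto simp: ga_star_def group_sum_def char_inv)
qed

lemma card_pos: "of_nat (card G) \<noteq> (0 :: complex)"
  using fin id_in by auto

end

section \<open>Conjugating subgroup sums, and cancelling a repeated symmetrizer\<close>

lemma conj_group_sum:
  assumes \<sigma>: "\<sigma> \<in> Sym N" and G: "G \<subseteq> Sym N" "G' \<subseteq> Sym N"
    and conj: "\<And>g. g \<in> Sym N \<Longrightarrow> \<sigma> \<circ> g \<circ> inv \<sigma> \<in> G' \<longleftrightarrow> g \<in> G"
    and char: "\<And>g. g \<in> Sym N \<Longrightarrow> \<eta> (\<sigma> \<circ> g \<circ> inv \<sigma>) = \<eta> g"
  shows "ga_mult N (ga_basis \<sigma>) (group_sum \<eta> G) = ga_mult N (group_sum \<eta> G') (ga_basis \<sigma>)"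
proof (rule ga_eqI[of _ N])
  fix k assume k: "k \<in> Sym N"
  have g: "inv \<sigma> \<circ> k \<in> Sym N" using k \<sigma> by (intro Sym_comp Sym_inv)
  have "k \<circ> inv \<sigma> = \<sigma> \<circ> (inv \<sigma> \<circ> k) \<circ> inv \<sigma>"
    using \<sigma> by simp
  then have "k \<circ> inv \<sigma> \<in> G' \<longleftrightarrow> inv \<sigma> \<circ> k \<in> G" "\<eta> (k \<circ> inv \<sigma>) = \<eta> (inv \<sigma> \<circ> k)"
    using conj[OF g] char[OF g] by metis+
  then show "ga_mult N (ga_basis \<sigma>) (group_sum \<eta> G) k = ga_mult N (group_sum \<eta> G') (ga_basis \<sigma>) k"
    using \<sigma> k by (simp add: ga_mult_basis_left ga_mult_basis_right group_sum_def)
qed auto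

text \<open>Since \<open>c = a b\<close> has adjoint \<open>b a\<close>, positivity is applied
  twice, through the intermediate element \<open>w = y a b a\<close>. Up to the factor
  \<open>m\<close>, \<open>w\<close> times its adjoint begins with \<open>y c c\<close>, so
  \<open>w = 0\<close>; up to the factor \<open>m'\<close>, \<open>y c\<close> times its adjoint
  begins with \<open>w\<close>, so \<open>y c = 0\<close>. The other side is the mirror image, with
  \<open>w = b a b y\<close>.\<close>

lemma ga_mult_square_cancel:
  fixes m m' :: complex
  assumes a: "ga_star N a = a" "ga_mult N a a = cscale m a" "m \<noteq> 0"
    and b: "ga_star N b = b" "ga_mult N b b = cscale m' b" "m' \<noteq> 0"
  defines "c \<equiv> ga_mult N a b"
  shows "ga_mult N y (ga_mult N c c) = 0 \<Longrightarrow> ga_mult N y c = 0"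
    and "ga_mult N (ga_mult N c c) y = 0 \<Longrightarrow> ga_mult N c y = 0"
proof -
  note assoc = ga_mult_assoc ga_star_mult a(1) b(1)
  have aa: "ga_mult N a (ga_mult N a x) = cscale m (ga_mult N a x)" for x
    by (simp add: a(2) ga_mult_scale flip: ga_mult_assoc)
  have bb: "ga_mult N b (ga_mult N b x) = cscale m' (ga_mult N b x)" for x
    by (simp add: b(2) ga_mult_scale flip: ga_mult_assoc)
  let ?s = "ga_star N y"
  {
    assume *: "ga_mult N y (ga_mult N c c) = 0"
    define w where "w = ga_mult N y (ga_mult N a (ga_mult N b a))"
    have "ga_mult N w (ga_star N w)
        = cscale m (ga_mult N (ga_mult N y (ga_mult N c c)) (ga_mult N a ?s))"
      by (simp add: w_def c_def assoc aa ga_mult_scale)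
    then have w0: "w = 0"
      using * by (intro ga_star_positive[of w N]) (auto simp: w_def cscale_simps)
    have "ga_mult N (ga_mult N y c) (ga_star N (ga_mult N y c)) = cscale m' (ga_mult N w ?s)"
      by (simp add: c_def w_def assoc bb ga_mult_scale)
    with w0 show "ga_mult N y c = 0"
      by - (rule ga_star_positive[of _ N], simp_all add: cscale_simps)
  }
  {
    assume *: "ga_mult N (ga_mult N c c) y = 0"
    define w where "w = ga_mult N b (ga_mult N a (ga_mult N b y))"
    have "ga_mult N (ga_star N w) w
        = cscale m' (ga_mult N (ga_mult N ?s b) (ga_mult N (ga_mult N c c) y))"
      by (simp add: w_def c_def assoc bb ga_mult_scale)
    then have w0: "w = 0"
      using * by (intro ga_star_positive'[of w N]) (auto simp: w_def cscale_simps)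
    have "ga_mult N (ga_star N (ga_mult N c y)) (ga_mult N c y) = cscale m (ga_mult N ?s w)"
      by (simp add: c_def w_def assoc aa ga_mult_scale)
    with w0 show "ga_mult N c y = 0"
      by - (rule ga_star_positive'[of _ N], simp_all add: cscale_simps)
  }
qed

section \<open>Young symmetrizers\<close>

lemma row_subgroup: "signed_subgroup (sum_list lam) (\<lambda>_. 1) (row_group lam T)"
  and col_subgroup: "signed_subgroup (sum_list lam) sign (col_group lam T)"
proof -
  have inv: "inv g ` R = R" if "g \<in> Sym (sum_list lam)" "g ` R = R" for g :: "nat \<Rightarrow> nat" and R
  proof -
    have "inv g ` (g ` R) = (inv g \<circ> g) ` R" by (simp add: image_comp)
    then show ?thesis using that Sym_inv_o(1)[OF that(1)] by simp
  qed
  have comp: "(g \<circ> h) ` R = R" if "g ` R = R" "h ` R = R" for g h :: "nat \<Rightarrow> nat" and R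
    using that by (metis image_comp)
  show "signed_subgroup (sum_list lam) (\<lambda>_. 1) (row_group lam T)"
    by unfold_locales
      (auto simp: row_group_def Sym_comp Sym_inv inv comp simp del: image_comp o_apply)
  show "signed_subgroup (sum_list lam) sign (col_group lam T)"
    by unfold_locales
      (auto simp: col_group_def Sym_comp Sym_inv inv comp sign_Sym simp del: image_comp o_apply)
qed

lemma young_symmetrizer_eq:
  "young_symmetrizer lam T = ga_mult (sum_list lam)
     (group_sum (\<lambda>_. 1) (row_group lam T)) (group_sum sign (col_group lam T))"
proof -
  interpret r: signed_subgroup "sum_list lam" "\<lambda>_. 1" "row_group lam T" by (rule row_subgroup)
  interpret c: signed_subgroup "sum_list lam" sign "col_group lam T" by (rule col_subgroup)
  show ?thesis
    unfolding young_symmetrizer_def group_sum_eq[OF r.fin, symmetric] group_sum_eq[OF c.fin, symmetric]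
    by (simp add: cscale_simps)
qed

lemma young_symmetrizer_in: "young_symmetrizer lam T \<in> group_algebra (sum_list lam)"
  by (simp add: young_symmetrizer_eq)

lemma young_symmetrizer_square_cancel:
  fixes T :: "nat \<times> nat \<Rightarrow> nat" and lam :: "nat list"
  defines "c \<equiv> young_symmetrizer lam T" and "N \<equiv> sum_list lam"
  shows "ga_mult N y (ga_mult N c c) = 0 \<Longrightarrow> ga_mult N y c = 0"
    and "ga_mult N (ga_mult N c c) y = 0 \<Longrightarrow> ga_mult N c y = 0"
proof -
  interpret r: signed_subgroup "sum_list lam" "\<lambda>_. 1" "row_group lam T" by (rule row_subgroup)
  interpret c: signed_subgroup "sum_list lam" sign "col_group lam T" by (rule col_subgroup)
  show "ga_mult N y (ga_mult N c c) = 0 \<Longrightarrow> ga_mult N y c = 0"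
    and "ga_mult N (ga_mult N c c) y = 0 \<Longrightarrow> ga_mult N c y = 0"
    unfolding c_def N_def young_symmetrizer_eq
    by (rule ga_mult_square_cancel[OF r.star_sum r.sum_mult_sum r.card_pos
          c.star_sum c.sum_mult_sum c.card_pos]; simp)+
qed

section \<open>Symmetrizers of tableaux of one shape\<close>

lemma tableau_inj: "T \<in> tableaux lam \<Longrightarrow> inj_on T (boxes lam)"
  by (auto simp: tableaux_def bij_betw_def)

text \<open>Such a permutation keeps each entry in its row and in its column, and these two
  determine the box.\<close>

lemma row_col_group_Int:
  assumes T: "T \<in> tableaux lam" and g: "g \<in> row_group lam T" "g \<in> col_group lam T"
  shows "g = id"
proof
  fix x
  have s: "g permutes {1..sum_list lam}" using g by (auto simp: row_group_def Sym_def)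
  show "g x = id x"
  proof (cases "x \<in> {1..sum_list lam}")
    case True
    then obtain b where b: "b \<in> boxes lam" "x = T b"
      using T unfolding tableaux_def bij_betw_def by blast
    have "x \<in> row_entries lam T (fst b)" "x \<in> col_entries lam T (snd b)"
      using b by (auto simp: row_entries_def col_entries_def)
    then have "g x \<in> row_entries lam T (fst b)" "g x \<in> col_entries lam T (snd b)"
      using g unfolding row_group_def col_group_def by blast+
    then obtain b1 b2 where "b1 \<in> boxes lam" "fst b1 = fst b" "g x = T b1"
      "b2 \<in> boxes lam" "snd b2 = snd b" "g x = T b2"
      by (auto simp: row_entries_def col_entries_def)
    moreover from this have "b1 = b2"
      using tableau_inj[OF T] by (metis inj_onD)
    ultimately have "b1 = b" by (simp add: prod_eq_iff)
    with \<open>g x = T b1\<close> show ?thesis using b by simp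
  qed (use s in \<open>simp add: permutes_not_in\<close>)
qed

text \<open>A row permutation times a column permutation is the identity only if both are trivial.
  This coefficient is how symmetrizers and elements of blocks are later seen to be non-zero.\<close>

lemma young_symmetrizer_id:
  assumes T: "T \<in> tableaux lam"
  shows "young_symmetrizer lam T id = 1"
proof -
  interpret r: signed_subgroup "sum_list lam" "\<lambda>_. 1" "row_group lam T" by (rule row_subgroup)
  interpret c: signed_subgroup "sum_list lam" sign "col_group lam T" by (rule col_subgroup)
  have "young_symmetrizer lam T id = (\<Sum>g\<in>Sym (sum_list lam). if g = id then 1 else 0)"
    unfolding young_symmetrizer_eq ga_mult_apply[OF Sym_id]
  proof (intro sum.cong refl)
    fix g assume g: "g \<in> Sym (sum_list lam)"
    have "g = id" if "g \<in> row_group lam T" "inv g \<in> col_group lam T"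
      using row_col_group_Int[OF T that(1)] c.inv_in[OF that(2)] g by simp
    then show "group_sum (\<lambda>_. 1) (row_group lam T) g * group_sum sign (col_group lam T) (inv g \<circ> id)
        = (if g = id then 1 else 0)"
      using r.id_in c.id_in by (auto simp: group_sum_def)
  qed
  then show ?thesis by simp
qed

lemma young_symmetrizer_nonzero: "T \<in> tableaux lam \<Longrightarrow> young_symmetrizer lam T \<noteq> 0"
  using young_symmetrizer_id by fastforce

text \<open>The permutation is \<open>S\<close> after the inverse of \<open>T\<close>. It carries
  rows to rows and columns to columns, so it conjugates the row and column groups of
  \<open>T\<close> into those of \<open>S\<close>, and conjugation preserves signs.\<close>

lemma tableaux_conj:
  assumes S: "S \<in> tableaux lam" and T: "T \<in> tableaux lam"
  obtains \<sigma> where "\<sigma> \<in> Sym (sum_list lam)"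
    "ga_mult (sum_list lam) (ga_basis \<sigma>) (young_symmetrizer lam T)
      = ga_mult (sum_list lam) (young_symmetrizer lam S) (ga_basis \<sigma>)"
proof -
  define \<sigma> where "\<sigma> x = (if x \<in> {1..sum_list lam} then S (inv_into (boxes lam) T x) else x)" for x
  let ?N = "sum_list lam"
  have bT: "bij_betw T (boxes lam) {1..?N}" and bS: "bij_betw S (boxes lam) {1..?N}"
    using S T by (auto simp: tableaux_def)
  have "bij_betw (S \<circ> inv_into (boxes lam) T) {1..?N} {1..?N}"
    using bij_betw_trans[OF bij_betw_inv_into[OF bT] bS] .
  then have "bij_betw \<sigma> {1..?N} {1..?N}"
    by (rule bij_betw_cong[THEN iffD1, rotated]) (simp add: \<sigma>_def)
  then have \<sigma>: "\<sigma> \<in> Sym ?N"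
    unfolding Sym_def by (auto simp: \<sigma>_def intro!: bij_imp_permutes)
  have \<sigma>T: "\<sigma> (T b) = S b" if "b \<in> boxes lam" for b
    using that bT by (auto simp: \<sigma>_def bij_betw_def)
  have ent: "row_entries lam S r = \<sigma> ` row_entries lam T r"
    "col_entries lam S r = \<sigma> ` col_entries lam T r" for r
    unfolding row_entries_def col_entries_def image_image
    by (auto simp: \<sigma>T intro!: image_cong)
  have img: "(\<sigma> \<circ> g \<circ> inv \<sigma>) ` (\<sigma> ` R) = \<sigma> ` R \<longleftrightarrow> g ` R = R" for g :: "nat \<Rightarrow> nat" and R
  proof -
    have "(\<sigma> \<circ> g \<circ> inv \<sigma>) ` (\<sigma> ` R) = \<sigma> ` (g ` R)"
      by (simp only: image_comp comp_assoc Sym_inv_o[OF \<sigma>] comp_id)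
    moreover have "inj \<sigma>" using \<sigma> by (auto simp: Sym_def permutes_inj)
    ultimately show ?thesis by (simp add: inj_image_eq_iff)
  qed
  have in_Sym: "\<sigma> \<circ> g \<circ> inv \<sigma> \<in> Sym ?N" if "g \<in> Sym ?N" for g
    using \<sigma> that by (intro Sym_comp Sym_inv)
  have sign_conj: "sign (\<sigma> \<circ> g \<circ> inv \<sigma>) = sign g" if "g \<in> Sym ?N" for g
    using sign_Sym(1)[OF Sym_comp[OF \<sigma> that] Sym_inv[OF \<sigma>]] sign_Sym(1)[OF \<sigma> that]
      sign_Sym(2)[OF \<sigma> \<sigma>] by (simp add: mult.commute)
  have "ga_mult ?N (ga_basis \<sigma>) (group_sum (\<lambda>_. 1) (row_group lam T))
      = ga_mult ?N (group_sum (\<lambda>_. 1) (row_group lam S)) (ga_basis \<sigma>)"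
    by (rule conj_group_sum[OF \<sigma>])
      (simp_all only: row_group_def in_Sym ent img mem_Collect_eq, auto)
  moreover have "ga_mult ?N (ga_basis \<sigma>) (group_sum sign (col_group lam T))
      = ga_mult ?N (group_sum sign (col_group lam S)) (ga_basis \<sigma>)"
    by (rule conj_group_sum[OF \<sigma>])
      (simp_all only: col_group_def in_Sym ent img mem_Collect_eq sign_conj, auto)
  ultimately have "ga_mult ?N (ga_basis \<sigma>) (young_symmetrizer lam T)
      = ga_mult ?N (young_symmetrizer lam S) (ga_basis \<sigma>)"
    unfolding young_symmetrizer_eq by (metis ga_mult_assoc)
  then show ?thesis using \<sigma> that by blast
qed

section \<open>Vanishing products of symmetrizers\<close>

lemma transpose_in_group:
  assumes "x \<noteq> z" "x \<in> R r" "z \<in> R r" "\<And>r. R r \<subseteq> {1..N}"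
    and "\<And>r r'. r \<noteq> r' \<Longrightarrow> R r \<inter> R r' = {}"
  shows "Transposition.transpose x z \<in> {g \<in> Sym N. \<forall>r. g ` R r = R r}"
proof -
  have "Transposition.transpose x z \<in> Sym N"
    using assms(2,3,4) unfolding Sym_def by (auto intro!: permutes_swap_id)
  moreover have "x \<in> R r' \<longleftrightarrow> z \<in> R r'" for r'
    using assms(2,3) assms(5)[of r r'] by blast
  then have "Transposition.transpose x z ` R r' = R r'" for r'
    by (auto simp: transpose_image_eq)
  ultimately show ?thesis by auto
qed

text \<open>The transposition of \<open>x\<close> and \<open>z\<close> is absorbed with sign -1 by
  the column sum of \<open>T\<close> and with sign 1 by the row sum of \<open>S\<close>. Inserted
  between these adjacent factors, it shows that their product equals its own negative.\<close>

lemma young_symmetrizer_mult_zero: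
  assumes S: "S \<in> tableaux lam" and T: "T \<in> tableaux mu" and N: "sum_list lam = N" "sum_list mu = N"
    and "x \<noteq> z" "x \<in> row_entries lam S r" "z \<in> row_entries lam S r"
    and "x \<in> col_entries mu T k" "z \<in> col_entries mu T k"
  shows "ga_mult N (young_symmetrizer mu T) (young_symmetrizer lam S) = 0"
proof -
  interpret r: signed_subgroup N "\<lambda>_. 1" "row_group lam S" using row_subgroup[of lam S] N by simp
  interpret c: signed_subgroup N sign "col_group mu T" using col_subgroup[of mu T] N by simp
  let ?t = "Transposition.transpose x z"
  let ?a = "group_sum (\<lambda>_. 1) (row_group lam S)" and ?b = "group_sum sign (col_group mu T)"
  have "?t \<in> row_group lam S"
    unfolding row_group_def N using S N assms(5-7) tableau_inj[OF S]
    by (intro transpose_in_group[where R = "row_entries lam S"])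
      (auto simp: row_entries_def tableaux_def bij_betw_def inj_on_eq_iff)
  then have a: "ga_mult N (ga_basis ?t) ?a = ?a"
    using r.basis_mult_sum[of ?t] by (simp add: cscale_simps)
  have "?t \<in> col_group mu T"
    unfolding col_group_def N using T N assms(5,8,9) tableau_inj[OF T]
    by (intro transpose_in_group[where R = "col_entries mu T"])
      (auto simp: col_entries_def tableaux_def bij_betw_def inj_on_eq_iff)
  then have b: "ga_mult N ?b (ga_basis ?t) = cscale (- 1) ?b"
    using c.sum_mult_basis[of ?t] \<open>x \<noteq> z\<close> by (simp add: sign_swap_id)
  have "ga_mult N ?b ?a = ga_mult N (ga_mult N ?b (ga_basis ?t)) ?a"
    by (simp add: a ga_mult_assoc)
  also have "\<dots> = cscale (- 1) (ga_mult N ?b ?a)"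
    by (simp only: b ga_mult_scale)
  finally have "ga_mult N ?b ?a g = - ga_mult N ?b ?a g" for g
    by (metis cscale_def mult_minus1)
  then have "ga_mult N ?b ?a = 0" by (simp add: fun_eq_iff)
  then have "ga_mult N ?b (ga_mult N ?a w) = 0" for w by (simp flip: ga_mult_assoc)
  then show ?thesis by (simp add: young_symmetrizer_eq N ga_mult_assoc)
qed

section \<open>Counting standard tableaux\<close>

text \<open>A Young diagram is encoded by its row lengths \<open>f 0 \<ge> f 1 \<ge> \<dots>\<close>.\<close>

definition cells :: "(nat \<Rightarrow> nat) \<Rightarrow> (nat \<times> nat) set"
  where "cells f = {(r, c). c < f r}"

definition shapes :: "nat \<Rightarrow> (nat \<Rightarrow> nat) set"
  where "shapes n = {f. (\<forall>r. f (Suc r) \<le> f r) \<and> finite (cells f) \<and> card (cells f) = n}"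

definition removable :: "(nat \<Rightarrow> nat) \<Rightarrow> nat set"
  where "removable f = {r. f (Suc r) < f r}"

text \<open>A box fits into row 0 or into a row strictly shorter than the one above it, that is,
  just below a removable row. In this form the excess of one over the removable rows is
  immediate.\<close>

definition addable :: "(nat \<Rightarrow> nat) \<Rightarrow> nat set"
  where "addable f = insert 0 (Suc ` removable f)"

abbreviation add_cell :: "(nat \<Rightarrow> nat) \<Rightarrow> nat \<Rightarrow> nat \<Rightarrow> nat"
  where "add_cell f r \<equiv> f(r := Suc (f r))"

abbreviation del_cell :: "(nat \<Rightarrow> nat) \<Rightarrow> nat \<Rightarrow> nat \<Rightarrow> nat"
  where "del_cell f r \<equiv> f(r := f r - 1)"

text \<open>The number of paths from the empty diagram to \<open>f\<close> in Young's lattice.\<close>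

fun paths :: "nat \<Rightarrow> (nat \<Rightarrow> nat) \<Rightarrow> nat"
  where
    "paths 0 f = 1"
  | "paths (Suc n) f = (\<Sum>r\<in>removable f. paths n (del_cell f r))"

lemma addable_iff: "r \<in> addable f \<longleftrightarrow> r = 0 \<or> f r < f (r - 1)"
  by (cases r) (auto simp: addable_def removable_def)

lemma finite_removable:
  assumes "f \<in> shapes n"
  shows "finite (removable f)"
proof (rule finite_subset)
  show "removable f \<subseteq> fst ` cells f"
    by (force simp: removable_def cells_def)
qed (use assms in \<open>simp add: shapes_def\<close>)

lemma finite_addable: "f \<in> shapes n \<Longrightarrow> finite (addable f)"
  by (simp add: addable_def finite_removable)

lemma card_addable: "f \<in> shapes n \<Longrightarrow> card (addable f) = Suc (card (removable f))"
  by (simp add: addable_def finite_removable card_image)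

lemma cells_add: "cells (add_cell f r) = insert (r, f r) (cells f)"
  by (auto simp: cells_def split: if_splits)

lemma add_cell_shape:
  assumes f: "f \<in> shapes n" and r: "r \<in> addable f"
  shows "add_cell f r \<in> shapes (Suc n)" "r \<in> removable (add_cell f r)"
proof -
  have "f (Suc i) \<le> f i" for i using f by (simp add: shapes_def)
  then show "r \<in> removable (add_cell f r)"
    by (simp add: removable_def less_Suc_eq_le)
  have "(r, f r) \<notin> cells f" by (simp add: cells_def)
  moreover have "add_cell f r (Suc i) \<le> add_cell f r i" for i
    using r \<open>\<And>i. f (Suc i) \<le> f i\<close>[of i] by (auto simp: addable_iff le_SucI Suc_leI)
  ultimately show "add_cell f r \<in> shapes (Suc n)"
    using f by (simp add: shapes_def cells_add)
qed

lemma del_cell_shape: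
  assumes f: "f \<in> shapes (Suc n)" and r: "r \<in> removable f"
  shows "del_cell f r \<in> shapes n" "r \<in> addable (del_cell f r)" "add_cell (del_cell f r) r = f"
proof -
  have mono: "f (Suc i) \<le> f i" for i using f by (simp add: shapes_def)
  have r': "f (Suc r) < f r" using r by (simp add: removable_def)
  then show eq: "add_cell (del_cell f r) r = f" by (auto simp: fun_eq_iff)
  have cells: "cells f = insert (r, f r - 1) (cells (del_cell f r))"
    using cells_add[of "del_cell f r" r] eq by simp
  have "(r, f r - 1) \<notin> cells (del_cell f r)" by (simp add: cells_def)
  moreover have "del_cell f r (Suc i) \<le> del_cell f r i" for i
    using r' mono[of i] by auto
  ultimately show "del_cell f r \<in> shapes n"
    using f cells by (auto simp: shapes_def simp del: One_nat_def)
  show "r \<in> addable (del_cell f r)"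
    using r' mono[of "r - 1"] by (auto simp: addable_iff)
qed

lemma shapes_0: "f \<in> shapes 0 \<Longrightarrow> f = (\<lambda>_. 0)"
  by (fastforce simp: shapes_def cells_def fun_eq_iff)

lemma shapes_0_mem: "(\<lambda>_. 0) \<in> shapes 0"
  by (simp add: shapes_def cells_def)

text \<open>Up and down moves in Young's lattice between different boxes commute, and a diagram has
  exactly one more addable than removable row.\<close>

lemma sum_paths_add:
  "f \<in> shapes n \<Longrightarrow> (\<Sum>r\<in>addable f. paths (Suc n) (add_cell f r)) = Suc n * paths n f"
proof (induction n arbitrary: f)
  case 0
  then have f: "f = (\<lambda>_. 0)" by (rule shapes_0)
  have "removable f = {}" "removable (add_cell f 0) = {0}"
    by (auto simp: f removable_def split: if_splits)
  then show ?case by (simp add: addable_def del: fun_upd_apply)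
next
  case (Suc n)
  note f = Suc.prems
  have mono: "f (Suc i) \<le> f i" for i using f by (simp add: shapes_def)
  \<comment> \<open>\<open>X\<close> holds the moves up in a row \<open>r\<close> and down in
    another row \<open>s\<close>. They match the moves down and then up, to which the induction
    hypothesis applies; the moves with \<open>r = s\<close> return to \<open>f\<close>, once per
    addable row on one side and once per removable row on the other.\<close>
  define X where "X = (\<Sum>r\<in>addable f. \<Sum>s\<in>removable (add_cell f r) - {r}. paths (Suc n) (del_cell (add_cell f r) s))"
  have "(\<Sum>r\<in>addable f. paths (Suc (Suc n)) (add_cell f r))
      = (\<Sum>r\<in>addable f. paths (Suc n) f
          + (\<Sum>s\<in>removable (add_cell f r) - {r}. paths (Suc n) (del_cell (add_cell f r) s)))"
  proof (intro sum.cong refl)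
    fix r assume r: "r \<in> addable f"
    note shape = add_cell_shape[OF f r]
    have "del_cell (add_cell f r) r = f" by (simp add: fun_eq_iff)
    then show "paths (Suc (Suc n)) (add_cell f r) = paths (Suc n) f
          + (\<Sum>s\<in>removable (add_cell f r) - {r}. paths (Suc n) (del_cell (add_cell f r) s))"
      by (subst paths.simps(2), subst sum.remove[OF finite_removable[OF shape(1)] shape(2)]) simp
  qed
  also have "\<dots> = Suc (card (removable f)) * paths (Suc n) f + X"
    by (simp add: sum.distrib X_def card_addable[OF f])
  finally have up: "(\<Sum>r\<in>addable f. paths (Suc (Suc n)) (add_cell f r))
      = Suc (card (removable f)) * paths (Suc n) f + X" .
  have "Suc n * paths (Suc n) f = (\<Sum>s\<in>removable f. Suc n * paths n (del_cell f s))"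
    by (simp only: paths.simps sum_distrib_left)
  also have "\<dots> = (\<Sum>s\<in>removable f. \<Sum>r\<in>addable (del_cell f s). paths (Suc n) (add_cell (del_cell f s) r))"
    by (intro sum.cong refl Suc.IH[symmetric] del_cell_shape(1)[OF f])
  also have "\<dots> = (\<Sum>s\<in>removable f. paths (Suc n) f
          + (\<Sum>r\<in>addable (del_cell f s) - {s}. paths (Suc n) (add_cell (del_cell f s) r)))"
  proof (intro sum.cong refl)
    fix s assume s: "s \<in> removable f"
    note shape = del_cell_shape[OF f s]
    show "(\<Sum>r\<in>addable (del_cell f s). paths (Suc n) (add_cell (del_cell f s) r)) = paths (Suc n) f
          + (\<Sum>r\<in>addable (del_cell f s) - {s}. paths (Suc n) (add_cell (del_cell f s) r))"
      by (subst sum.remove[OF finite_addable[OF shape(1)] shape(2)]) (simp only: shape(3))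
  qed
  also have "\<dots> = card (removable f) * paths (Suc n) f
      + (\<Sum>s\<in>removable f. \<Sum>r\<in>addable (del_cell f s) - {s}. paths (Suc n) (add_cell (del_cell f s) r))"
    by (simp add: sum.distrib)
  also have "(\<Sum>s\<in>removable f. \<Sum>r\<in>addable (del_cell f s) - {s}. paths (Suc n) (add_cell (del_cell f s) r)) = X"
  proof -
    have iff: "s \<in> removable f \<and> r \<in> addable (del_cell f s) - {s}
        \<longleftrightarrow> r \<in> addable f \<and> s \<in> removable (add_cell f r) - {r}" for r s
      by (auto simp: addable_iff removable_def split: if_splits)
    have comm: "add_cell (del_cell f s) r = del_cell (add_cell f r) s" if "r \<noteq> s" for r s
      using that by (auto simp: fun_eq_iff)
    have fin: "finite (removable f)" "finite (addable f)"
      by (rule finite_removable[OF f] finite_addable[OF f])+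
    have fin1: "finite (addable (del_cell f s) - {s})" if "s \<in> removable f" for s
      using finite_addable[OF del_cell_shape(1)[OF f that]] by simp
    have fin2: "finite (removable (add_cell f r) - {r})" if "r \<in> addable f" for r
      using finite_removable[OF add_cell_shape(1)[OF f that]] by simp
    have "(\<Sum>s\<in>removable f. \<Sum>r\<in>addable (del_cell f s) - {s}. paths (Suc n) (add_cell (del_cell f s) r))
        = (\<Sum>(s, r)\<in>(SIGMA s:removable f. addable (del_cell f s) - {s}).
            paths (Suc n) (add_cell (del_cell f s) r))"
      using fin fin1 by (intro sum.Sigma) auto
    also have "\<dots> = (\<Sum>(r, s)\<in>(SIGMA r:addable f. removable (add_cell f r) - {r}).
            paths (Suc n) (del_cell (add_cell f r) s))"
      by (rule sum.reindex_bij_witness[of _ "\<lambda>(r, s). (s, r)" "\<lambda>(s, r). (r, s)"])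
        (use iff in \<open>auto simp del: paths.simps One_nat_def fun_upd_apply\<close>, metis comm)
    also have "\<dots> = X"
      unfolding X_def using fin fin2 by (intro sum.Sigma[symmetric]) auto
    finally show ?thesis .
  qed
  finally show ?case unfolding up by (simp del: paths.simps)
qed

text \<open>Without a descent the row lengths are constant, and a positive constant would give
  infinitely many boxes.\<close>

lemma removable_nonempty:
  assumes "f \<in> shapes (Suc n)"
  shows "removable f \<noteq> {}"
proof
  assume *: "removable f = {}"
  have mono: "f (Suc i) \<le> f i" for i using assms by (simp add: shapes_def)
  have const: "f i = f 0" for i
  proof (induction i)
    case (Suc i)
    have "\<not> f (Suc i) < f i" using * by (auto simp: removable_def)
    with mono[of i] Suc show ?case by simp
  qed simp
  obtain r c where "(r, c) \<in> cells f"
  proof -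
    have "card (cells f) = Suc n" using assms unfolding shapes_def by blast
    then have "cells f \<noteq> {}" by (metis card.empty nat.distinct(1))
    then show ?thesis using that by fast
  qed
  then have "c < f r" by (simp add: cells_def)
  then have "0 < f i" for i using const[of i] const[of r] by linarith
  then have "range (\<lambda>i. (i, 0 :: nat)) \<subseteq> cells f"
    by (auto simp: cells_def)
  then have "finite (range (\<lambda>i :: nat. (i, 0 :: nat)))"
    using assms finite_subset by (auto simp: shapes_def)
  moreover have "inj (\<lambda>i :: nat. (i, 0 :: nat))" by (auto intro: injI)
  ultimately show False using finite_imageD by blast
qed

text \<open>The edges between two levels of Young's lattice, indexed from the lower and from the
  upper end.\<close>

lemma shapes_Suc_bij:
  "bij_betw (\<lambda>(h, r). (add_cell h r, r)) (SIGMA h:shapes n. addable h) (SIGMA f:shapes (Suc n). removable f)"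
proof (rule bij_betw_byWitness[of _ "\<lambda>(f, r). (del_cell f r, r)"])
  show "\<forall>a'\<in>(SIGMA f:shapes (Suc n). removable f).
      (\<lambda>(h, r). (add_cell h r, r)) ((\<lambda>(f, r). (del_cell f r, r)) a') = a'"
    by (auto simp del: fun_upd_apply fun_upd_upd One_nat_def simp: del_cell_shape(3))
  show "(\<lambda>(h, r). (add_cell h r, r)) ` (SIGMA h:shapes n. addable h)
      \<subseteq> (SIGMA f:shapes (Suc n). removable f)"
    using add_cell_shape by auto
  show "(\<lambda>(f, r). (del_cell f r, r)) ` (SIGMA f:shapes (Suc n). removable f)
      \<subseteq> (SIGMA h:shapes n. addable h)"
    using del_cell_shape(1,2) by (auto simp del: One_nat_def)
qed auto

lemma finite_shapes: "finite (shapes n)"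
proof (induction n)
  case 0
  show ?case by (rule finite_subset[of _ "{\<lambda>_. 0}"]) (auto dest: shapes_0)
next
  case (Suc n)
  have "finite (SIGMA h:shapes n. addable h)"
    using Suc finite_addable by blast
  then have "finite (SIGMA f:shapes (Suc n). removable f)"
    using bij_betw_finite[OF shapes_Suc_bij] by blast
  then have "finite (fst ` (SIGMA f:shapes (Suc n). removable f))" by simp
  moreover have "shapes (Suc n) \<subseteq> fst ` (SIGMA f:shapes (Suc n). removable f)"
    using removable_nonempty by force
  ultimately show ?case by (rule finite_subset[rotated])
qed

text \<open>Expanding one of the two factors \<open>paths (Suc n) f\<close> turns the sum into one
  over edges of Young's lattice. Summed from the lower end instead, the edges above \<open>h\<close>
  contribute \<open>Suc n\<close> times the square of \<open>paths n h\<close>.\<close>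

lemma sum_paths_square: "(\<Sum>f\<in>shapes n. paths n f * paths n f) = fact n"
proof (induction n)
  case 0
  have "shapes 0 = {\<lambda>_. 0}" using shapes_0 shapes_0_mem by blast
  then show ?case by simp
next
  case (Suc n)
  have "(\<Sum>f\<in>shapes (Suc n). paths (Suc n) f * paths (Suc n) f)
      = (\<Sum>f\<in>shapes (Suc n). \<Sum>r\<in>removable f. paths (Suc n) f * paths n (del_cell f r))"
    by (simp add: sum_distrib_left)
  also have "\<dots> = (\<Sum>(f, r)\<in>(SIGMA f:shapes (Suc n). removable f). paths (Suc n) f * paths n (del_cell f r))"
    by (intro sum.Sigma) (auto simp: finite_shapes finite_removable)
  also have "\<dots> = (\<Sum>(h, r)\<in>(SIGMA h:shapes n. addable h). paths (Suc n) (add_cell h r) * paths n h)"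
    by (subst sum.reindex_bij_betw[OF shapes_Suc_bij, symmetric], intro sum.cong refl)
      (auto simp del: paths.simps)
  also have "\<dots> = (\<Sum>h\<in>shapes n. (\<Sum>r\<in>addable h. paths (Suc n) (add_cell h r)) * paths n h)"
    unfolding sum_distrib_right
    by (intro sum.Sigma[symmetric]) (auto simp: finite_shapes finite_addable)
  also have "\<dots> = (\<Sum>h\<in>shapes n. Suc n * (paths n h * paths n h))"
    by (intro sum.cong refl) (simp only: sum_paths_add mult.assoc)
  also have "\<dots> = Suc n * (\<Sum>h\<in>shapes n. paths n h * paths n h)"
    by (rule sum_distrib_left[symmetric])
  finally show ?case using Suc by simp
qed

section \<open>Standard fillings obtained from paths in Young's lattice\<close>

text \<open>Standardness for an arbitrary set of boxes, so that boxes can be added and removed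
  without passing through lists of row lengths.\<close>

definition standard_fillings :: "(nat \<times> nat) set \<Rightarrow> (nat \<times> nat \<Rightarrow> nat) set"
  where "standard_fillings D = {t \<in> extensional D. bij_betw t D {1..card D} \<and>
    (\<forall>r c c'. (r, c) \<in> D \<and> (r, c') \<in> D \<and> c < c' \<longrightarrow> t (r, c) < t (r, c')) \<and>
    (\<forall>r r' c. (r, c) \<in> D \<and> (r', c) \<in> D \<and> r < r' \<longrightarrow> t (r, c) < t (r', c))}"

lemma finite_standard_fillings: "finite D \<Longrightarrow> finite (standard_fillings D)"
  by (rule finite_subset[of _ "D \<rightarrow>\<^sub>E {1..card D}"], force simp: standard_fillings_def PiE_def dest: bij_betwE)
    (intro finite_PiE, auto)

lemma shapes_antimono: "f \<in> shapes n \<Longrightarrow> r \<le> r' \<Longrightarrow> f r' \<le> f r"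
  by (rule lift_Suc_antimono_le) (auto simp: shapes_def)

text \<open>Adding a box with the entry \<open>n + 1\<close> produces standard fillings, and the position of that
  entry recovers the box.\<close>

lemma paths_le_card: "f \<in> shapes n \<Longrightarrow> paths n f \<le> card (standard_fillings (cells f))"
proof (induction n arbitrary: f)
  case 0
  then have "cells f = {}" by (auto simp: shapes_def)
  then have "standard_fillings (cells f) = {\<lambda>_. undefined}"
    by (auto simp: standard_fillings_def bij_betw_def)
  then show ?case by simp
next
  case (Suc n)
  note f = Suc.prems
  define U where "U = (SIGMA s:removable f. standard_fillings (cells (del_cell f s)))"
  define ext where "ext = (\<lambda>(s, t). t((s, f s - 1) := Suc n) :: nat \<times> nat \<Rightarrow> nat)"
  have fin: "finite (cells f)" "card (cells f) = Suc n" using f by (auto simp: shapes_def)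
  have cells: "cells f = insert (s, f s - 1) (cells (del_cell f s))" "(s, f s - 1) \<notin> cells (del_cell f s)"
    "card (cells (del_cell f s)) = n" "finite (cells (del_cell f s))" if "s \<in> removable f" for s
  proof -
    note shape = del_cell_shape[OF f that]
    show "cells f = insert (s, f s - 1) (cells (del_cell f s))"
      using cells_add[of "del_cell f s" s] unfolding shape(3) by simp
    show "(s, f s - 1) \<notin> cells (del_cell f s)" by (simp add: cells_def)
    show "card (cells (del_cell f s)) = n" "finite (cells (del_cell f s))"
      using shape(1) unfolding shapes_def by blast+
  qed
  have entry: "t b \<in> {1..n}" if "s \<in> removable f" "t \<in> standard_fillings (cells (del_cell f s))"
    "b \<in> cells (del_cell f s)" for s t b
    using that cells(3)[OF that(1)] by (auto simp: standard_fillings_def dest: bij_betwE)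
  have "ext (s, t) \<in> standard_fillings (cells f)"
    if s: "s \<in> removable f" and t: "t \<in> standard_fillings (cells (del_cell f s))" for s t
  proof -
    let ?b = "(s, f s - 1)"
    let ?D = "cells (del_cell f s)"
    have e: "ext (s, t) b = (if b = ?b then Suc n else t b)" for b
      by (simp add: ext_def)
    have e_new: "ext (s, t) ?b = Suc n" by (simp add: e)
    have e_old: "ext (s, t) b = t b" if "b \<in> ?D" for b
      using that cells(2)[OF s] by (auto simp: e)
    have bt: "bij_betw t ?D {1..n}" and tr: "\<And>r c c'. (r, c) \<in> ?D \<Longrightarrow> (r, c') \<in> ?D \<Longrightarrow> c < c' \<Longrightarrow> t (r, c) < t (r, c')"
      and tc: "\<And>r r' c. (r, c) \<in> ?D \<Longrightarrow> (r', c) \<in> ?D \<Longrightarrow> r < r' \<Longrightarrow> t (r, c) < t (r', c)"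
      and tx: "t \<in> extensional ?D"
      using t cells(3)[OF s] by (auto simp: standard_fillings_def)
    have "bij_betw (ext (s, t)) ?D {1..n}"
      using bt cells(2)[OF s] by (subst bij_betw_cong[of _ _ t]) (auto simp: e)
    then have "bij_betw (ext (s, t)) (?D \<union> {?b}) ({1..n} \<union> {ext (s, t) ?b})"
      by (intro notIn_Un_bij_betw) (use cells(2)[OF s] in \<open>auto simp: e\<close>)
    moreover have "?D \<union> {?b} = cells f" "{1..n} \<union> {ext (s, t) ?b} = {1..Suc n}"
      by (subst cells(1)[OF s], simp) (auto simp: e)
    ultimately have bij: "bij_betw (ext (s, t)) (cells f) {1..card (cells f)}"
      by (simp add: fin)
    \<comment> \<open>The entry \<open>Suc n\<close> exceeds all others, so its box has to end its
      row and its column; the latter is the removability of \<open>s\<close>.\<close>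
    have s_last: "f (Suc s) < f s" using s by (simp add: removable_def)
    have last_row: "c \<le> f s - 1" if "(s, c) \<in> cells f" for c
      using that by (auto simp: cells_def)
    have last_col: "r \<le> s" if "(r, f s - 1) \<in> cells f" for r
    proof (rule ccontr)
      assume "\<not> r \<le> s"
      then have "f r \<le> f (Suc s)" using shapes_antimono[OF f, of "Suc s" r] by simp
      then show False using s_last that by (simp add: cells_def)
    qed
    have mem: "b \<in> ?D" if "b \<in> cells f" "b \<noteq> ?b" for b using that cells(1)[OF s] by auto
    have "ext (s, t) (r, c) < ext (s, t) (r, c')"
      if "(r, c) \<in> cells f" "(r, c') \<in> cells f" "c < c'" for r c c'
    proof -
      have "(r, c) \<noteq> ?b" using last_row[of c'] that by auto
      then have d: "(r, c) \<in> ?D" using mem that by blast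
      show ?thesis
      proof (cases "(r, c') = ?b")
        case True
        show ?thesis
          unfolding True e_old[OF d] e_new using entry[OF s t d] by simp
      next
        case False
        show ?thesis
          unfolding e_old[OF d] e_old[OF mem[OF that(2) False]]
          by (rule tr[OF d mem[OF that(2) False] that(3)])
      qed
    qed
    moreover have "ext (s, t) (r, c) < ext (s, t) (r', c)"
      if "(r, c) \<in> cells f" "(r', c) \<in> cells f" "r < r'" for r r' c
    proof -
      have "(r, c) \<noteq> ?b" using last_col[of r'] that by auto
      then have d: "(r, c) \<in> ?D" using mem that by blast
      show ?thesis
      proof (cases "(r', c) = ?b")
        case True
        show ?thesis
          unfolding True e_old[OF d] e_new using entry[OF s t d] by simp
      next
        case False
        show ?thesis
          unfolding e_old[OF d] e_old[OF mem[OF that(2) False]]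
          by (rule tc[OF d mem[OF that(2) False] that(3)])
      qed
    qed
    moreover have "ext (s, t) \<in> extensional (cells f)"
      using tx cells(1)[OF s] by (auto simp: e extensional_def)
    ultimately show ?thesis using bij unfolding standard_fillings_def by blast
  qed
  then have image: "ext ` U \<subseteq> standard_fillings (cells f)" by (auto simp: U_def)
  have "inj_on ext U"
  proof (rule inj_onI)
    fix u u' assume u: "u \<in> U" "u' \<in> U" and eq: "ext u = ext u'"
    obtain s t s' t' where st: "u = (s, t)" "u' = (s', t')" by (cases u, cases u')
    have s: "s \<in> removable f" "t \<in> standard_fillings (cells (del_cell f s))"
      and s': "s' \<in> removable f" "t' \<in> standard_fillings (cells (del_cell f s'))"
      using u st by (auto simp: U_def)
    have "s = s'"
    proof (rule ccontr)
      assume ne: "s \<noteq> s'"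
      have "(s, f s - 1) \<in> cells (del_cell f s')"
        using cells(1)[OF s(1)] cells(1)[OF s'(1)] ne by blast
      then have "t' (s, f s - 1) \<le> n" using entry[OF s'] by auto
      moreover have "ext u (s, f s - 1) = Suc n" "ext u' (s, f s - 1) = t' (s, f s - 1)"
        using ne by (auto simp: ext_def st)
      ultimately show False using eq by simp
    qed
    moreover have "t = t'"
    proof (rule extensionalityI)
      show "t \<in> extensional (cells (del_cell f s))" "t' \<in> extensional (cells (del_cell f s))"
        using s s' \<open>s = s'\<close> by (auto simp: standard_fillings_def)
      fix b assume "b \<in> cells (del_cell f s)"
      then have "b \<noteq> (s, f s - 1)" using cells(2)[OF s(1)] by auto
      then show "t b = t' b"
        using fun_cong[OF eq, of b] \<open>s = s'\<close> by (simp add: ext_def st)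
    qed
    ultimately show "u = u'" using st by simp
  qed
  have "paths (Suc n) f \<le> (\<Sum>s\<in>removable f. card (standard_fillings (cells (del_cell f s))))"
    unfolding paths.simps by (intro sum_mono Suc.IH del_cell_shape(1)[OF f])
  also have "\<dots> = card U"
    unfolding U_def
    by (subst card_SigmaI) (auto simp: finite_removable[OF f] finite_standard_fillings cells(4) simp del: One_nat_def)
  also have "\<dots> = card (ext ` U)" using \<open>inj_on ext U\<close> by (simp add: card_image)
  also have "\<dots> \<le> card (standard_fillings (cells f))"
    by (rule card_mono[OF finite_standard_fillings[OF fin(1)] image])
  finally show ?case .
qed

section \<open>From row-length functions to partitions\<close>

lemma boxes_eq_Sigma: "boxes lam = (SIGMA r:{..<length lam}. {..<lam ! r})"
  by (auto simp: boxes_def)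

lemma card_boxes: "card (boxes lam) = sum_list lam"
  unfolding boxes_eq_Sigma by (subst card_SigmaI) (auto simp: sum_list_sum_nth atLeast0LessThan)

lemma standard_tableaux_eq: "standard_tableaux lam = standard_fillings (boxes lam)"
  by (auto simp: standard_tableaux_def standard_fillings_def tableaux_def card_boxes)

text \<open>The rows are cut off at the first empty one, which exists because only finitely many
  boxes \<open>(r, 0)\<close> occur; by monotonicity all later rows are empty too, and the entries
  kept are positive.\<close>

lemma shape_diagram:
  assumes f: "f \<in> shapes n"
  shows "\<exists>lam\<in>young_diagrams n. boxes lam = cells f"
proof -
  have "finite ((\<lambda>r. (r, 0 :: nat)) -` cells f)"
    using f by (intro finite_vimageI) (auto simp: shapes_def intro: injI)
  then obtain r where "r \<notin> (\<lambda>r. (r, 0 :: nat)) -` cells f"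
    using ex_new_if_finite infinite_UNIV_nat by blast
  then have "f r = 0" by (simp add: cells_def)
  define k where "k = (LEAST r. f r = 0)"
  have k0: "f k = 0" unfolding k_def using \<open>f r = 0\<close> by (rule LeastI)
  have k: "r < k \<longleftrightarrow> 0 < f r" for r
    using not_less_Least[of r "\<lambda>r. f r = 0"] shapes_antimono[OF f, of k r] k0
    unfolding k_def[symmetric] by linarith
  have boxes: "boxes (map f [0..<k]) = cells f"
  proof -
    have "(r, c) \<in> boxes (map f [0..<k]) \<longleftrightarrow> r < k \<and> c < f r" for r c
      by (auto simp: boxes_def)
    moreover have "r < k \<and> c < f r \<longleftrightarrow> c < f r" for r c
      using k[of r] by linarith
    ultimately show ?thesis by (auto simp: cells_def)
  qed
  have "sorted_wrt (\<ge>) (map f [0..<k])"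
    by (auto simp: sorted_wrt_iff_nth_less intro: shapes_antimono[OF f])
  moreover have "sum_list (map f [0..<k]) = n"
    using f card_boxes[of "map f [0..<k]"] boxes by (simp add: shapes_def)
  moreover have "\<forall>x\<in>set (map f [0..<k]). 1 \<le> x"
    by (auto simp: Suc_le_eq k[symmetric])
  ultimately have "map f [0..<k] \<in> young_diagrams n"
    unfolding young_diagrams_def by blast
  with boxes show ?thesis by (rule bexI)
qed

section \<open>Standard tableaux\<close>

text \<open>All shapes in one index set, because the triangular order compares tableaux of different
  shapes as well.\<close>

definition syt :: "nat \<Rightarrow> (nat list \<times> (nat \<times> nat \<Rightarrow> nat)) set"
  where "syt N = (SIGMA lam:young_diagrams N. standard_tableaux lam)"

definition ysym :: "nat list \<times> (nat \<times> nat \<Rightarrow> nat) \<Rightarrow> (nat \<Rightarrow> nat) \<Rightarrow> complex"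
  where "ysym p = young_symmetrizer (fst p) (snd p)"

lemma length_le_sum_list: "\<forall>x\<in>set lam. 1 \<le> x \<Longrightarrow> length lam \<le> sum_list lam" for lam :: "nat list"
  by (induction lam) auto

lemma young_diagram_box:
  assumes "lam \<in> young_diagrams N" "(r, c) \<in> boxes lam"
  shows "r < N" "c < N" "r' \<le> r \<Longrightarrow> c' \<le> c \<Longrightarrow> (r', c') \<in> boxes lam"
proof -
  have lam: "sorted_wrt (\<ge>) lam" "length lam \<le> N" "sum_list lam = N"
    using assms(1) length_le_sum_list[of lam] by (auto simp: young_diagrams_def)
  have rc: "r < length lam" "c < lam ! r"
    using assms(2) by (auto simp: boxes_def)
  show "r < N" using rc lam by simp
  have "lam ! r \<le> N" using elem_le_sum_list[OF rc(1)] lam by simp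
  then show "c < N" using rc by simp
  assume "r' \<le> r" "c' \<le> c"
  moreover have "lam ! r \<le> lam ! r'"
    using lam(1) rc \<open>r' \<le> r\<close> by (cases "r' = r") (auto simp: sorted_wrt_iff_nth_less)
  ultimately show "(r', c') \<in> boxes lam" using rc by (auto simp: boxes_def)
qed

text \<open>Positive parts rule out trailing zeros, so the boxes in column 0 count the rows.\<close>

lemma boxes_inj:
  assumes "lam \<in> young_diagrams N" "mu \<in> young_diagrams N" "boxes lam = boxes mu"
  shows "lam = mu"
proof -
  have row: "{c. (r, c) \<in> boxes lam} = (if r < length lam then {..<lam ! r} else {})" for r and lam
    by (auto simp: boxes_def)
  have pos: "r < length lam \<longleftrightarrow> (r, 0) \<in> boxes lam" if "lam \<in> young_diagrams N" for r and lam
  proof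
    assume r: "r < length lam"
    then have "1 \<le> lam ! r" using that nth_mem[OF r] unfolding young_diagrams_def by blast
    with r show "(r, 0) \<in> boxes lam" by (simp add: boxes_def)
  qed (simp add: boxes_def)
  have iff: "r < length lam \<longleftrightarrow> r < length mu" for r
    using pos[OF assms(1)] pos[OF assms(2)] assms(3) by metis
  show ?thesis
  proof (rule nth_equalityI)
    show "length lam = length mu"
      using iff by (meson linorder_neqE_nat less_irrefl)
    fix r assume r: "r < length lam"
    then have "{..<lam ! r} = {..<mu ! r}"
      using row[of r lam] row[of r mu] iff[of r] assms(3) by simp
    then show "lam ! r = mu ! r" by simp
  qed
qed

lemma syt_tableau:
  assumes "p \<in> syt N"
  shows "fst p \<in> young_diagrams N" "snd p \<in> tableaux (fst p)" "sum_list (fst p) = N"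
    "snd p \<in> standard_tableaux (fst p)"
  using assms by (auto simp: syt_def standard_tableaux_def young_diagrams_def)

lemma syt_entry: "p \<in> syt N \<Longrightarrow> b \<in> boxes (fst p) \<Longrightarrow> snd p b \<le> N"
  using syt_tableau[of p N] by (fastforce simp: tableaux_def bij_betw_def)

lemma finite_boxes: "lam \<in> young_diagrams N \<Longrightarrow> finite (boxes lam)"
  by (rule finite_subset[of _ "{..<N} \<times> {..<N}"]) (auto dest: young_diagram_box(1,2))

lemma finite_young_diagrams: "finite (young_diagrams N)"
proof (rule finite_subset)
  show "young_diagrams N \<subseteq> {xs. set xs \<subseteq> {..N} \<and> length xs \<le> N}"
    using length_le_sum_list member_le_sum_list by (fastforce simp: young_diagrams_def)
qed (simp add: finite_lists_length_le)

lemma finite_standard_tableaux: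
  assumes "lam \<in> young_diagrams N"
  shows "finite (standard_tableaux lam)"
proof (rule finite_subset)
  show "standard_tableaux lam \<subseteq> boxes lam \<rightarrow>\<^sub>E {1..sum_list lam}"
    by (auto simp: standard_tableaux_def tableaux_def PiE_def dest: bij_betwE)
qed (intro finite_PiE finite_boxes[OF assms], simp)

lemma finite_syt [simp]: "finite (syt N)"
  unfolding syt_def by (intro finite_SigmaI finite_young_diagrams finite_standard_tableaux)

text \<open>Positions outside the diagram count as larger than all entries.\<close>

definition reading :: "nat \<Rightarrow> nat list \<times> (nat \<times> nat \<Rightarrow> nat) \<Rightarrow> nat \<Rightarrow> nat"
  where "reading N p i =
    (let b = (i div N, i mod N) in if b \<in> boxes (fst p) then snd p b else Suc N)"

text \<open>A diagram with \<open>N\<close> boxes fits into an \<open>N\<close> by \<open>N\<close>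
  square, which is read row by row; \<open>less_fun\<close> decides at the first differing
  position.\<close>

definition reading_less ::
  "nat \<Rightarrow> nat list \<times> (nat \<times> nat \<Rightarrow> nat) \<Rightarrow> nat list \<times> (nat \<times> nat \<Rightarrow> nat) \<Rightarrow> bool"
  where "reading_less N p q = less_fun (reading N p) (reading N q)"

lemma reading_box:
  assumes "c < N"
  shows "reading N p (r * N + c) = (if (r, c) \<in> boxes (fst p) then snd p (r, c) else Suc N)"
  using assms by (simp add: reading_def)

lemma reading_inj:
  assumes p: "p \<in> syt N" and q: "q \<in> syt N" and eq: "reading N p = reading N q"
  shows "p = q"
proof -
  have *: "b \<in> boxes (fst q) \<and> snd q b = snd p b"
    if "p \<in> syt N" "q \<in> syt N" "reading N p = reading N q" "b \<in> boxes (fst p)" for p q b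
  proof -
    obtain r c where b: "b = (r, c)" by (cases b)
    then have "c < N" using young_diagram_box(2)[OF syt_tableau(1)[OF that(1)]] that(4) by blast
    then show ?thesis
      using reading_box[of c N p r] reading_box[of c N q r] that syt_entry[of p N b]
      by (auto simp: b split: if_splits)
  qed
  have boxes: "boxes (fst p) = boxes (fst q)"
    using *[OF p q eq] *[OF q p eq[symmetric]] by blast
  then have "fst p = fst q"
    using boxes_inj syt_tableau(1) p q by blast
  moreover have "snd p = snd q"
  proof (rule extensionalityI)
    show "snd p \<in> extensional (boxes (fst p))" "snd q \<in> extensional (boxes (fst p))"
      using syt_tableau(2)[OF p] syt_tableau(2)[OF q] boxes by (auto simp: tableaux_def)
  qed (use *[OF p q eq] in auto)
  ultimately show ?thesis by (simp add: prod_eq_iff)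
qed

lemma reading_less_order:
  "asymp_on (syt N) (reading_less N)" "transp_on (syt N) (reading_less N)"
  "totalp_on (syt N) (reading_less N)"
proof -
  show "asymp_on (syt N) (reading_less N)"
    by (auto simp: asymp_on_def reading_less_def dest: less_fun_asym)
  show "transp_on (syt N) (reading_less N)"
    by (auto simp: transp_on_def reading_less_def intro: less_fun_trans)
  show "totalp_on (syt N) (reading_less N)"
  proof (rule totalp_onI)
    fix p q assume p: "p \<in> syt N" and q: "q \<in> syt N" and ne: "p \<noteq> q"
    \<comment> \<open>Trichotomy for \<open>less_fun\<close> requires finitely many differences;
      beyond the square both readings are \<open>Suc N\<close>.\<close>
    have "{i. reading N p i \<noteq> reading N q i} \<subseteq> {..<N * N}"
    proof
      fix i assume "i \<in> {i. reading N p i \<noteq> reading N q i}"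
      then have "(i div N, i mod N) \<in> boxes (fst p) \<or> (i div N, i mod N) \<in> boxes (fst q)"
        by (auto simp: reading_def Let_def split: if_splits)
      then have "i div N < N" "i mod N < N"
        using young_diagram_box(1,2) syt_tableau(1) p q by blast+
      then have "i < N * N" by (metis less_mult_imp_div_less div_less_iff_less_mult less_nat_zero_code not_gr_zero)
      then show "i \<in> {..<N * N}" by simp
    qed
    then have "finite {i. reading N p i \<noteq> reading N q i}"
      using finite_subset by blast
    from less_fun_trichotomy[OF this] show "reading_less N p q \<or> reading_less N q p"
      using reading_inj[OF p q] ne by (auto simp: reading_less_def)
  qed
qed

text \<open>At the first difference in reading order, the entry \<open>x\<close> of the smaller tableau lies further
  down and to the left in the larger one; the two tableaux agree on the box \<open>(r, c')\<close> of
  the same row and the column in question.\<close>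

lemma reading_less_pair:
  assumes p: "p \<in> syt N" and q: "q \<in> syt N" and less: "reading_less N p q"
  obtains x z r k where "x \<noteq> z"
    "x \<in> row_entries (fst p) (snd p) r" "z \<in> row_entries (fst p) (snd p) r"
    "x \<in> col_entries (fst q) (snd q) k" "z \<in> col_entries (fst q) (snd q) k"
proof -
  note tp = syt_tableau[OF p] and tq = syt_tableau[OF q]
  obtain i where i: "reading N p i < reading N q i"
    and before: "\<And>i'. i' < i \<Longrightarrow> reading N p i' = reading N q i'"
    using less unfolding reading_less_def less_fun_def by blast
  define r c where "r = i div N" and "c = i mod N"
  \<comment> \<open>The default \<open>Suc N\<close> is the largest possible value, so at the first
    difference the smaller tableau really has a box.\<close>
  have "reading N q i \<le> Suc N"
    using syt_entry[OF q] by (auto simp: reading_def Let_def le_SucI)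
  then have bp: "(r, c) \<in> boxes (fst p)"
    using i by (auto simp: reading_def Let_def r_def c_def split: if_splits)
  have rN: "r < N" and cN: "c < N" using young_diagram_box[OF tp(1) bp] by auto
  have i_eq: "i = r * N + c" by (simp add: r_def c_def)
  have agree: "((r', c') \<in> boxes (fst p) \<longleftrightarrow> (r', c') \<in> boxes (fst q)) \<and>
      ((r', c') \<in> boxes (fst p) \<longrightarrow> snd p (r', c') = snd q (r', c'))"
    if "c' < N" "r' < r \<or> r' = r \<and> c' < c" for r' c'
  proof -
    have "r' * N + c' < i"
    proof (cases "r' < r")
      case True
      then have "(r' + 1) * N \<le> r * N" by (intro mult_le_mono1) simp
      then show ?thesis using that(1) by (simp add: i_eq)
    qed (use that in \<open>simp add: i_eq\<close>)
    then show ?thesis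
      using before[of "r' * N + c'"] syt_entry[OF p, of "(r', c')"] syt_entry[OF q, of "(r', c')"]
      by (auto simp: reading_box[OF that(1)] split: if_splits)
  qed
  define x where "x = snd p (r, c)"
  have xN: "x \<in> {1..N}"
    using tp(2,3) bp by (auto simp: tableaux_def x_def dest: bij_betwE)
  then obtain b where "b \<in> boxes (fst q)" "snd q b = x"
    using tq(2,3) by (metis (no_types, lifting) bij_betw_imp_surj_on imageE mem_Collect_eq tableaux_def)
  moreover obtain r' c' where "b = (r', c')" by (cases b)
  ultimately have b: "(r', c') \<in> boxes (fst q)" "snd q (r', c') = x"
    by simp_all
  have c'N: "c' < N" using young_diagram_box[OF tq(1) b(1)] by auto
  have not_before: "\<not> (r' < r \<or> r' = r \<and> c' < c)"
  proof
    assume *: "r' < r \<or> r' = r \<and> c' < c"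
    then have "(r', c') \<in> boxes (fst p)" "snd p (r', c') = x"
      using agree[OF c'N *] b by auto
    then have "(r', c') = (r, c)"
      using tableau_inj[OF tp(2)] bp by (metis inj_onD x_def)
    with * show False by simp
  qed
  have std: "snd q (r, c) < snd q (r, c')" if "(r, c) \<in> boxes (fst q)" "(r, c') \<in> boxes (fst q)" "c < c'" for r c c'
    using tq(4) that unfolding standard_tableaux_def by blast
  have std': "snd q (r, c) < snd q (r', c)" if "(r, c) \<in> boxes (fst q)" "(r', c) \<in> boxes (fst q)" "r < r'" for r r' c
    using tq(4) that unfolding standard_tableaux_def by blast
  \<comment> \<open>Otherwise \<open>x\<close> would lie weakly below and to the right of
    \<open>(r, c)\<close> in \<open>q\<close>, so standardness would make the entry of
    \<open>q\<close> at \<open>(r, c)\<close> at most \<open>x\<close>; at the first difference it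
    is larger.\<close>
  have "c' < c"
  proof (rule ccontr)
    assume "\<not> c' < c"
    then have le: "r \<le> r'" "c \<le> c'" using not_before by auto
    have q1: "(r, c) \<in> boxes (fst q)" and q2: "(r', c) \<in> boxes (fst q)"
      using young_diagram_box(3)[OF tq(1) b(1)] le by auto
    have "snd q (r, c) \<le> snd q (r', c)"
      using std'[OF q1 q2] le by (cases "r = r'") auto
    also have "\<dots> \<le> snd q (r', c')"
      using std[OF q2 b(1)] le by (cases "c = c'") auto
    finally have "snd q (r, c) \<le> x" using b by simp
    moreover have "x < snd q (r, c)"
      using i bp q1 by (simp add: i_eq reading_box[OF cN] x_def)
    ultimately show False by simp
  qed
  have bz: "(r, c') \<in> boxes (fst p)"
    using young_diagram_box(3)[OF tp(1) bp] \<open>c' < c\<close> by auto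
  define z where "z = snd p (r, c')"
  have z: "(r, c') \<in> boxes (fst q)" "snd q (r, c') = z"
    using agree[OF c'N] \<open>c' < c\<close> bz by (auto simp: z_def)
  have "x \<noteq> z"
    using tableau_inj[OF tp(2)] bp bz \<open>c' < c\<close> unfolding x_def z_def by (auto dest: inj_onD)
  moreover have "x \<in> row_entries (fst p) (snd p) r" "z \<in> row_entries (fst p) (snd p) r"
    using bp bz by (force simp: row_entries_def x_def z_def)+
  moreover have "x \<in> col_entries (fst q) (snd q) c'" "z \<in> col_entries (fst q) (snd q) c'"
    using b z by (force simp: col_entries_def)+
  ultimately show ?thesis using that by blast
qed

lemma ysym_mult_zero:
  assumes "p \<in> syt N" "q \<in> syt N" "reading_less N p q"
  shows "ga_mult N (ysym q) (ysym p) = 0"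
  using reading_less_pair[OF assms] unfolding ysym_def
  by (metis young_symmetrizer_mult_zero syt_tableau(2,3) assms(1,2))

lemma ysym_in: "p \<in> syt N \<Longrightarrow> ysym p \<in> group_algebra N"
  using young_symmetrizer_in[of "fst p" "snd p"] syt_tableau(3)[of p N] by (simp add: ysym_def)

lemma ysym_id: "p \<in> syt N \<Longrightarrow> ysym p id = 1"
  by (simp add: ysym_def young_symmetrizer_id syt_tableau)

lemma ysym_square_cancel:
  assumes "p \<in> syt N"
  shows "ga_mult N y (ga_mult N (ysym p) (ysym p)) = 0 \<Longrightarrow> ga_mult N y (ysym p) = 0"
    "ga_mult N (ga_mult N (ysym p) (ysym p)) y = 0 \<Longrightarrow> ga_mult N (ysym p) y = 0"
  using young_symmetrizer_square_cancel[where T = "snd p" and lam = "fst p" and y = y] syt_tableau(3)[OF assms]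
  by (auto simp: ysym_def)

section \<open>The group algebra as a sum of Peirce blocks\<close>

text \<open>If some terms were non-zero, take the \<open>R\<close>-least such index \<open>q\<close>
  and apply \<open>f q\<close>: every other non-zero term is killed, and cancellation gives
  \<open>y q = 0\<close>. The map \<open>f\<close> is left abstract to cover left multiplication,
  right multiplication and the action on a module.\<close>

lemma triangular_sum_zero:
  fixes f :: "'p \<Rightarrow> ('a \<Rightarrow> complex) \<Rightarrow> 'b \<Rightarrow> complex"
  assumes "finite I" "asymp_on I R" "transp_on I R" "totalp_on I R"
    and sum: "\<And>q. q \<in> I \<Longrightarrow> f q (\<Sum>p\<in>I. y p) = (\<Sum>p\<in>I. f q (y p))" and zero: "\<And>q. f q 0 = 0"
    and triangular: "\<And>p q. p \<in> I \<Longrightarrow> q \<in> I \<Longrightarrow> R q p \<Longrightarrow> f q (y p) = 0"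
    and cancel: "\<And>q. q \<in> I \<Longrightarrow> f q (y q) = 0 \<Longrightarrow> y q = 0"
    and eq: "(\<Sum>p\<in>I. y p) = 0" and p: "p \<in> I"
  shows "y p = 0"
proof (rule ccontr)
  assume "y p \<noteq> 0"
  define J where "J = {p \<in> I. y p \<noteq> 0}"
  have J: "J \<subseteq> I" "J \<noteq> {}" "finite J" using assms(1) p \<open>y p \<noteq> 0\<close> by (auto simp: J_def)
  obtain q where q: "q \<in> J" "\<forall>x\<in>J. x \<noteq> q \<longrightarrow> R q x"
    using Finite_Set.bex_least_element[of J R] J assms(2-4)
    by (metis asymp_on_subset transp_on_subset totalp_on_subset)
  have qI: "q \<in> I" using q J by auto
  have "0 = (\<Sum>p\<in>I. f q (y p))" using sum[OF qI] eq zero by simp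
  also have "\<dots> = (\<Sum>p\<in>I. if p = q then f q (y q) else 0)"
  proof (intro sum.cong refl)
    fix p assume "p \<in> I"
    then show "f q (y p) = (if p = q then f q (y q) else 0)"
      using q triangular[OF _ qI, of p] zero[of q] by (cases "y p = 0") (auto simp: J_def)
  qed
  also have "\<dots> = f q (y q)" using qI assms(1) by simp
  finally have "y q = 0" using cancel[OF qI] by simp
  then show False using q by (simp add: J_def)
qed

text \<open>Since the product reads only values on \<open>Sym N\<close>, the two ranges are
  \<open>c_p A\<close> and \<open>A c_q\<close>. The intersection, unlike \<open>c_p A c_q\<close>,
  admits an element as soon as it is seen from each side separately, such as
  \<open>e_\<sigma> c_q = c_p e_\<sigma>\<close>.\<close>

definition block ::
  "nat \<Rightarrow> nat list \<times> (nat \<times> nat \<Rightarrow> nat) \<Rightarrow> nat list \<times> (nat \<times> nat \<Rightarrow> nat)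
    \<Rightarrow> ((nat \<Rightarrow> nat) \<Rightarrow> complex) set"
  where "block N p q = range (ga_mult N (ysym p)) \<inter> range (\<lambda>z. ga_mult N z (ysym q))"

lemma block_subspace: "cfun.subspace (block N p q)"
proof -
  have "cfun.subspace (range (ga_mult N a))" "cfun.subspace (range (\<lambda>z. ga_mult N z a))" for a
  proof -
    have "cscale k (ga_mult N a z) \<in> range (ga_mult N a)"
      "cscale k (ga_mult N z a) \<in> range (\<lambda>z. ga_mult N z a)" for k z
      by (rule range_eqI[of _ _ "cscale k z"], simp add: ga_mult_scale)+
    then show "cfun.subspace (range (ga_mult N a))" "cfun.subspace (range (\<lambda>z. ga_mult N z a))"
      unfolding cfun.subspace_def
      by (auto simp flip: ga_mult_add intro: range_eqI[of _ _ 0])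
  qed
  then show ?thesis unfolding block_def by (rule cfun.subspace_inter)
qed

lemma blockE:
  assumes "y \<in> block N p q"
  shows "\<exists>z. y = ga_mult N (ysym p) z" "\<exists>z. y = ga_mult N z (ysym q)"
  using assms by (auto simp: block_def)

lemma block_in: "y \<in> block N p q \<Longrightarrow> y \<in> group_algebra N"
  using ga_mult_in by (auto simp: block_def)

text \<open>Right multiplications separate the columns, since the partial sum for fixed
  \<open>q\<close> lies in \<open>A c_q\<close>; left multiplications then separate the terms of one
  column.\<close>

lemma block_direct:
  assumes y: "\<And>p q. p \<in> syt N \<Longrightarrow> q \<in> syt N \<Longrightarrow> y p q \<in> block N p q"
    and sum: "(\<Sum>q\<in>syt N. \<Sum>p\<in>syt N. y p q) = 0"
    and pq: "p \<in> syt N" "q \<in> syt N"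
  shows "y p q = 0"
proof -
  note order = reading_less_order[of N]
  have col: "(\<Sum>p\<in>syt N. y p q) = 0" if q: "q \<in> syt N" for q
  proof (rule triangular_sum_zero[where f = "\<lambda>q z. ga_mult N z (ysym q)" and R = "reading_less N"
        and y = "\<lambda>q. \<Sum>p\<in>syt N. y p q", OF finite_syt order _ _ _ _ sum q])
    have "\<exists>z. (\<Sum>p\<in>syt N. y p q) = ga_mult N z (ysym q)" if "q \<in> syt N" for q
    proof -
      have "\<exists>z. y p q = ga_mult N z (ysym q)" if "p \<in> syt N" for p
        using blockE(2)[OF y[OF that \<open>q \<in> syt N\<close>]] .
      then obtain z where "\<And>p. p \<in> syt N \<Longrightarrow> y p q = ga_mult N (z p) (ysym q)" by metis
      then have "(\<Sum>p\<in>syt N. y p q) = ga_mult N (\<Sum>p\<in>syt N. z p) (ysym q)"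
        by (simp add: ga_mult_sum)
      then show ?thesis by blast
    qed
    then obtain z where z: "\<And>q. q \<in> syt N \<Longrightarrow> (\<Sum>p\<in>syt N. y p q) = ga_mult N (z q) (ysym q)"
      by metis
    show "ga_mult N (\<Sum>p\<in>syt N. y p q) (ysym q') = 0"
      if "q \<in> syt N" "q' \<in> syt N" "reading_less N q' q" for q q'
      using that by (simp add: z ga_mult_assoc ysym_mult_zero)
    show "(\<Sum>p\<in>syt N. y p q) = 0"
      if "q \<in> syt N" "ga_mult N (\<Sum>p\<in>syt N. y p q) (ysym q) = 0" for q
      using that ysym_square_cancel(1)[OF that(1), of "z q"] by (simp add: z ga_mult_assoc)
  qed (simp_all add: ga_mult_sum)
  \<comment> \<open>On the left, \<open>c_p' c_p\<close> vanishes when \<open>p\<close> is the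
    smaller tableau, so this pass uses the reversed order.\<close>
  have order':
    "asymp_on (syt N) (\<lambda>p p'. reading_less N p' p)"
    "transp_on (syt N) (\<lambda>p p'. reading_less N p' p)"
    "totalp_on (syt N) (\<lambda>p p'. reading_less N p' p)"
    using order unfolding asymp_on_def transp_on_def totalp_on_def by blast+
  show ?thesis
  proof (rule triangular_sum_zero[where f = "\<lambda>p. ga_mult N (ysym p)"
        and R = "\<lambda>p p'. reading_less N p' p" and y = "\<lambda>p. y p q",
        OF finite_syt order' _ _ _ _ col[OF pq(2)] pq(1)])
    have "\<exists>z. y p q = ga_mult N (ysym p) z" if "p \<in> syt N" for p
      using blockE(1)[OF y[OF that pq(2)]] .
    then obtain z where z: "\<And>p. p \<in> syt N \<Longrightarrow> y p q = ga_mult N (ysym p) (z p)" by metis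
    show "ga_mult N (ysym p') (y p q) = 0"
      if "p \<in> syt N" "p' \<in> syt N" "reading_less N p p'" for p p'
      using that by (simp add: z ysym_mult_zero flip: ga_mult_assoc)
    show "y p q = 0" if "p \<in> syt N" "ga_mult N (ysym p) (y p q) = 0" for p
      using that ysym_square_cancel(2)[OF that(1), of "z p"] by (simp add: z ga_mult_assoc)
  qed (simp_all add: ga_mult_sum)
qed

text \<open>Distinct row-length functions give distinct Young diagrams, each with at least
  \<open>paths\<close> many standard tableaux. The reverse bound is supplied later by independence
  in an algebra of dimension at most N!.\<close>

lemma card_same_shape: "fact N \<le> card {(p, q) \<in> syt N \<times> syt N. fst p = fst q}"
proof -
  define g where "g f = (SOME lam. lam \<in> young_diagrams N \<and> boxes lam = cells f)" for f
  have g: "g f \<in> young_diagrams N \<and> boxes (g f) = cells f" if "f \<in> shapes N" for f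
    unfolding g_def by (rule someI_ex[OF shape_diagram[OF that, unfolded Bex_def]])
  have "inj_on g (shapes N)"
  proof (rule inj_onI)
    fix f f' assume "f \<in> shapes N" "f' \<in> shapes N" "g f = g f'"
    then have "cells f = cells f'" using g by metis
    then have "c < f r \<longleftrightarrow> c < f' r" for r c
      by (simp add: cells_def set_eq_iff)
    then have "f r = f' r" for r by (meson less_irrefl linorder_neqE_nat)
    then show "f = f'" by (simp add: fun_eq_iff)
  qed
  define h where "h lam = card (standard_tableaux lam)" for lam
  have "fact N = (\<Sum>f\<in>shapes N. paths N f * paths N f)"
    by (rule sum_paths_square[symmetric])
  also have "\<dots> \<le> (\<Sum>f\<in>shapes N. h (g f) * h (g f))"
    using paths_le_card g
    by (intro sum_mono mult_mono) (auto simp: h_def standard_tableaux_eq)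
  also have "\<dots> = (\<Sum>lam\<in>g ` shapes N. h lam * h lam)"
    by (simp add: sum.reindex \<open>inj_on g (shapes N)\<close>)
  also have "\<dots> \<le> (\<Sum>lam\<in>young_diagrams N. h lam * h lam)"
    using g by (intro sum_mono2 finite_young_diagrams) auto
  also have "\<dots> = card (SIGMA lam:young_diagrams N. standard_tableaux lam \<times> standard_tableaux lam)"
    by (subst card_SigmaI) (auto simp: h_def card_cartesian_product finite_young_diagrams finite_standard_tableaux)
  also have "\<dots> \<le> card {(p, q) \<in> syt N \<times> syt N. fst p = fst q}"
  proof (rule card_inj_on_le)
    show "inj_on (\<lambda>(lam, S, T). ((lam, S), (lam, T)))
        (SIGMA lam:young_diagrams N. standard_tableaux lam \<times> standard_tableaux lam)"
      by (auto simp: inj_on_def)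
    show "finite {(p, q) \<in> syt N \<times> syt N. fst p = fst q}"
      by (rule finite_subset[of _ "syt N \<times> syt N"]) auto
  qed (auto simp: syt_def)
  finally show ?thesis .
qed

text \<open>There are at least \<open>N!\<close> non-zero blocks, and their sum is direct: so this is the whole group
  algebra, and the non-zero blocks are one-dimensional.\<close>

lemma block_decomposition:
  obtains x where "\<And>p q. x p q \<in> block N p q" "\<And>p. p \<in> syt N \<Longrightarrow> x p p \<noteq> 0"
    "\<And>a. a \<in> group_algebra N \<Longrightarrow>
      \<exists>\<beta>. a = (\<Sum>q\<in>syt N. \<Sum>p\<in>syt N. cscale (\<beta> p q) (x p q))"
proof -
  let ?E = "{(p, q) \<in> syt N \<times> syt N. fst p = fst q}"
  have ex: "\<exists>x. x \<in> block N p q \<and> x \<noteq> 0" if "(p, q) \<in> ?E" for p q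
  proof -
    have p: "p \<in> syt N" and q: "q \<in> syt N" and sh: "fst p = fst q" using that by auto
    note tp = syt_tableau[OF p] and tq = syt_tableau[OF q]
    \<comment> \<open>Conjugacy makes \<open>c_p e_\<sigma>\<close> also a left multiple of
      \<open>c_q\<close>; its coefficient at \<open>\<sigma>\<close> is that of \<open>c_p\<close>
      at the identity.\<close>
    obtain \<sigma> where \<sigma>: "\<sigma> \<in> Sym N" "ga_mult N (ga_basis \<sigma>) (ysym q) = ga_mult N (ysym p) (ga_basis \<sigma>)"
      using tableaux_conj[of "snd p" "fst p" "snd q"] tp(2,3) tq(2) sh by (auto simp: ysym_def)
    have "ga_mult N (ysym p) (ga_basis \<sigma>) \<sigma> = 1"
      using \<sigma>(1) p by (simp add: ga_mult_basis_right ysym_id)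
    then have "ga_mult N (ysym p) (ga_basis \<sigma>) \<noteq> 0" by fastforce
    moreover have "ga_mult N (ysym p) (ga_basis \<sigma>) \<in> block N p q"
      unfolding block_def using \<sigma>(2) by (metis IntI rangeI)
    ultimately show ?thesis by blast
  qed
  \<comment> \<open>The value 0 for different shapes lets sums run over all pairs, as
    \<open>block_direct\<close> expects.\<close>
  define x where
    "x p q = (if (p, q) \<in> ?E then SOME x. x \<in> block N p q \<and> x \<noteq> 0 else 0)" for p q
  have x: "x p q \<in> block N p q" "(p, q) \<in> ?E \<Longrightarrow> x p q \<noteq> 0" for p q
    using someI_ex[OF ex[of p q]] cfun.subspace_0[OF block_subspace[of N p q]]
    unfolding x_def by presburger+
  have finE: "finite ?E" by (rule finite_subset[of _ "syt N \<times> syt N"]) auto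
  have sumE: "(\<Sum>q\<in>syt N. \<Sum>p\<in>syt N. cscale (\<beta> p q) (x p q))
      = (\<Sum>(p, q)\<in>?E. cscale (\<beta> p q) (x p q))" for \<beta>
  proof -
    have "(\<Sum>q\<in>syt N. \<Sum>p\<in>syt N. cscale (\<beta> p q) (x p q))
        = (\<Sum>(p, q)\<in>syt N \<times> syt N. cscale (\<beta> p q) (x p q))"
      by (subst sum.swap) (simp add: sum.cartesian_product)
    also have "\<dots> = (\<Sum>(p, q)\<in>?E. cscale (\<beta> p q) (x p q))"
      by (rule sum.mono_neutral_right) (auto simp: x_def cscale_simps)
    finally show ?thesis .
  qed
  have indep: "\<beta> p q = 0" if "(\<Sum>(p, q)\<in>?E. cscale (\<beta> p q) (x p q)) = 0" "(p, q) \<in> ?E" for \<beta> p q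
  proof -
    have "cscale (\<beta> p q) (x p q) = 0"
      by (rule block_direct[where y = "\<lambda>p q. cscale (\<beta> p q) (x p q)" and N = N])
        (use that sumE in \<open>auto intro: cfun.subspace_scale block_subspace x\<close>)
    then show ?thesis using x(2)[OF that(2)] by (simp add: cscale_eq_0_iff)
  qed
  define X where "X = (\<lambda>(p, q). x p q)"
  have inj: "inj_on X ?E"
  proof (rule inj_onI, rule ccontr)
    fix e e' assume e: "e \<in> ?E" "e' \<in> ?E" "X e = X e'" "e \<noteq> e'"
    \<comment> \<open>Two pairs with the same vector would give the relation with coefficients 1 and
      -1.\<close>
    define \<beta> where "\<beta> p q = (if (p, q) = e then 1 else if (p, q) = e' then - 1 else 0 :: complex)" for p q
    have "(\<Sum>(p, q)\<in>?E. cscale (\<beta> p q) (x p q))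
        = (\<Sum>d\<in>?E. (if d = e then X e else 0) - (if d = e' then X e' else 0))"
      using e(4) by (intro sum.cong refl) (auto simp: \<beta>_def X_def cscale_simps fun_eq_iff cscale_def)
    also have "\<dots> = X e - X e'"
      using e finE by (simp only: sum_subtractf sum.delta if_True)
    finally have "(\<Sum>(p, q)\<in>?E. cscale (\<beta> p q) (x p q)) = 0" using e by simp
    from indep[OF this, of "fst e" "snd e"] e(1) show False by (simp add: \<beta>_def)
  qed
  have ind: "cfun.independent (X ` ?E)"
  proof (rule cfun.independent_if_scalars_zero)
    fix f w assume s: "(\<Sum>w\<in>X ` ?E. cscale (f w) w) = 0" and w: "w \<in> X ` ?E"
    have "(\<Sum>(p, q)\<in>?E. cscale (f (x p q)) (x p q)) = (\<Sum>w\<in>X ` ?E. cscale (f w) w)"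
      unfolding sum.reindex[OF inj] by (auto simp: X_def intro!: sum.cong)
    then show "f w = 0"
      using indep[of "\<lambda>p q. f (x p q)"] s w by (auto simp: X_def)
  qed (use finE in simp)
  have sub: "X ` ?E \<subseteq> group_algebra N"
    using block_in[OF x(1)] by (auto simp: X_def)
  have span: "group_algebra N \<subseteq> cfun.span (X ` ?E)"
  proof (rule ccontr)
    assume "\<not> group_algebra N \<subseteq> cfun.span (X ` ?E)"
    then obtain a where a: "a \<in> group_algebra N" "a \<notin> cfun.span (X ` ?E)" by blast
    have "cfun.independent (insert a (X ` ?E))"
      using ind a(2) by (rule cfun.independent_insertI[rotated])
    moreover have "insert a (X ` ?E) \<subseteq> cfun.span (ga_basis ` Sym N)"
      using a(1) sub by (simp add: group_algebra_span)
    ultimately have "card (insert a (X ` ?E)) \<le> card (ga_basis ` Sym N)"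
      by (rule cfun.independent_span_bound[OF finite_imageI[OF finite_Sym], THEN conjunct2])
    also have "\<dots> \<le> fact N"
      using card_image_le[OF finite_Sym, of ga_basis N] by (simp add: Sym_def card_permutations)
    also have "\<dots> \<le> card ?E" by (rule card_same_shape)
    also have "\<dots> = card (X ` ?E)" by (rule card_image[OF inj, symmetric])
    finally have "card (insert a (X ` ?E)) \<le> card (X ` ?E)" .
    moreover have "a \<notin> X ` ?E" using a(2) cfun.span_base[of a "X ` ?E"] by metis
    ultimately show False using finE by simp
  qed
  show ?thesis
  proof (rule that[OF x(1)])
    show "x p p \<noteq> 0" if "p \<in> syt N" for p using x(2)[of p p] that by simp
    fix a assume "a \<in> group_algebra N"
    then have "a \<in> range (\<lambda>u. \<Sum>w\<in>X ` ?E. cscale (u w) w)"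
      using subsetD[OF span] cfun.span_finite[OF finite_imageI[OF finE, of X]] by simp
    then obtain u where "a = (\<Sum>w\<in>X ` ?E. cscale (u w) w)" by blast
    also have "\<dots> = (\<Sum>(p, q)\<in>?E. cscale (u (x p q)) (x p q))"
      unfolding sum.reindex[OF inj] by (auto simp: X_def intro!: sum.cong)
    finally have "a = (\<Sum>q\<in>syt N. \<Sum>p\<in>syt N. cscale (u (x p q)) (x p q))"
      by (simp only: sumE)
    then show "\<exists>\<beta>. a = (\<Sum>q\<in>syt N. \<Sum>p\<in>syt N. cscale (\<beta> p q) (x p q))"
      by (rule exI[of _ "\<lambda>p q. u (x p q)"])
  qed
qed

section \<open>Consequences for a single symmetrizer and for the identity\<close>

text \<open>Both \<open>c y c\<close> and \<open>c\<close> lie in the diagonal block of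
  \<open>p\<close>, which is a line, and \<open>c\<close> is not zero.\<close>

lemma ysym_sandwich:
  assumes p: "p \<in> syt N"
  obtains s where "ga_mult N (ysym p) (ga_mult N y (ysym p)) = cscale s (ysym p)"
proof -
  obtain x where x: "\<And>p q. x p q \<in> block N p q" "\<And>p. p \<in> syt N \<Longrightarrow> x p p \<noteq> 0"
    "\<And>a. a \<in> group_algebra N \<Longrightarrow>
      \<exists>\<beta>. a = (\<Sum>q\<in>syt N. \<Sum>p\<in>syt N. cscale (\<beta> p q) (x p q))"
    using block_decomposition by blast
  have multiple: "\<exists>\<beta>. w = cscale \<beta> (x p p)" if w: "w \<in> block N p p" for w
  proof -
    have "w \<in> group_algebra N" using w by (rule block_in)
    then obtain \<beta> where \<beta>: "w = (\<Sum>q\<in>syt N. \<Sum>p\<in>syt N. cscale (\<beta> p q) (x p q))"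
      using x(3) by blast
    \<comment> \<open>Subtracting \<open>w\<close> from the \<open>(p, p)\<close> term of its own
      expansion gives a family of block elements with sum 0; independence then compares the
      \<open>(p, p)\<close> terms.\<close>
    define y where "y p' q' = cscale (\<beta> p' q') (x p' q') - (if q' = p then if p' = p then w else 0 else 0)" for p' q'
    have "(\<Sum>q'\<in>syt N. \<Sum>p'\<in>syt N. if q' = p then if p' = p then w else 0 else 0)
        = (\<Sum>q'\<in>syt N. if q' = p then w else 0)"
      using p by (intro sum.cong refl) (simp add: sum.delta)
    also have "\<dots> = w" using p by (simp add: sum.delta)
    finally have sum: "(\<Sum>q'\<in>syt N. \<Sum>p'\<in>syt N. y p' q') = 0"
      using \<beta> by (simp add: y_def sum_subtractf)
    have "y p' q' \<in> block N p' q'" for p' q'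
      unfolding y_def
      by (rule cfun.subspace_diff[OF block_subspace cfun.subspace_scale[OF block_subspace x(1)]])
        (use w cfun.subspace_0[OF block_subspace] in simp)
    from block_direct[OF this sum p p] show ?thesis by (auto simp: y_def)
  qed
  have "ysym p \<in> block N p p"
    unfolding block_def using ga_mult_one[OF ysym_in[OF p]] by (metis IntI rangeI)
  then obtain \<gamma> where \<gamma>: "ysym p = cscale \<gamma> (x p p)" using multiple by blast
  have "\<gamma> \<noteq> 0" using \<gamma> ysym_id[OF p] by (auto simp: cscale_simps)
  have "ga_mult N (ysym p) (ga_mult N y (ysym p)) \<in> block N p p"
    unfolding block_def
    by (rule IntI[OF rangeI range_eqI[of _ _ "ga_mult N (ysym p) y"]]) (simp add: ga_mult_assoc)
  then obtain \<beta> where "ga_mult N (ysym p) (ga_mult N y (ysym p)) = cscale \<beta> (x p p)"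
    using multiple by blast
  also have "\<dots> = cscale (\<beta> / \<gamma>) (ysym p)"
    using \<open>\<gamma> \<noteq> 0\<close> by (subst \<gamma>) (simp add: cscale_simps)
  finally show ?thesis by (rule that)
qed

text \<open>The scalar comes from the sandwich with the identity in the middle. If it were 0,
  cancellation would turn \<open>c c = 0\<close> into \<open>c = 0\<close>.\<close>

lemma ysym_square:
  assumes p: "p \<in> syt N"
  obtains \<kappa> where "\<kappa> \<noteq> 0" "ga_mult N (ysym p) (ysym p) = cscale \<kappa> (ysym p)"
proof -
  obtain \<kappa> where "ga_mult N (ysym p) (ga_mult N (ga_basis id) (ysym p)) = cscale \<kappa> (ysym p)"
    using ysym_sandwich[OF p] by blast
  then have eq: "ga_mult N (ysym p) (ysym p) = cscale \<kappa> (ysym p)"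
    by (simp add: ga_mult_one ysym_in[OF p])
  have "\<kappa> \<noteq> 0"
  proof
    assume "\<kappa> = 0"
    then have "ga_mult N (ga_basis id) (ga_mult N (ysym p) (ysym p)) = 0"
      by (simp add: eq cscale_simps)
    then have "ysym p = 0"
      using ysym_square_cancel(1)[OF p, of "ga_basis id"] by (simp only: ga_mult_one ysym_in[OF p])
    then show False using ysym_id[OF p] by simp
  qed
  with eq show ?thesis using that by blast
qed

text \<open>The identity is expanded in the blocks, and each block vector is read as a left multiple
  of its right-hand symmetrizer. Applied to a vector, this shows that the components span.\<close>

lemma ysym_generate:
  obtains z where "ga_basis id = (\<Sum>p\<in>syt N. ga_mult N (z p) (ysym p))"
proof -
  obtain x where x: "\<And>p q. x p q \<in> block N p q" "\<And>p. p \<in> syt N \<Longrightarrow> x p p \<noteq> 0"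
    "\<And>a. a \<in> group_algebra N \<Longrightarrow>
      \<exists>\<beta>. a = (\<Sum>q\<in>syt N. \<Sum>p\<in>syt N. cscale (\<beta> p q) (x p q))"
    using block_decomposition[of N] by blast
  have "\<forall>p q. \<exists>z. x p q = ga_mult N z (ysym q)" using blockE(2)[OF x(1)] by blast
  then obtain z where z: "\<And>p q. x p q = ga_mult N (z p q) (ysym q)" by metis
  obtain \<beta> where "ga_basis id = (\<Sum>q\<in>syt N. \<Sum>p\<in>syt N. cscale (\<beta> p q) (x p q))"
    using x(3)[of "ga_basis id"] by auto
  also have "\<dots> = (\<Sum>q\<in>syt N. ga_mult N (\<Sum>p\<in>syt N. cscale (\<beta> p q) (z p q)) (ysym q))"
    by (simp add: ga_mult_sum ga_mult_scale z)
  finally show ?thesis by (rule that)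
qed

section \<open>Permutation modules\<close>

locale perm_module =
  fixes N :: nat and V :: "((nat \<Rightarrow> nat) \<Rightarrow> complex) set"
  assumes V_subspace: "cfun.subspace V"
    and perm_act_in: "\<And>v \<sigma>. v \<in> V \<Longrightarrow> \<sigma> \<in> Sym N \<Longrightarrow> perm_act v \<sigma> \<in> V"
begin

definition component :: "nat list \<times> (nat \<times> nat \<Rightarrow> nat) \<Rightarrow> ((nat \<Rightarrow> nat) \<Rightarrow> complex) set"
  where "component p = (\<lambda>v. ga_act N v (ysym p)) ` V"

definition commutant :: "(((nat \<Rightarrow> nat) \<Rightarrow> complex) \<Rightarrow> (nat \<Rightarrow> nat) \<Rightarrow> complex) set"
  where "commutant = {b \<in> endomorphisms V. \<forall>v\<in>V. \<forall>\<sigma>\<in>Sym N. b (perm_act v \<sigma>) = perm_act (b v) \<sigma>}"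

lemma act_in: "v \<in> V \<Longrightarrow> ga_act N v a \<in> V"
  unfolding ga_act_def
  by (intro cfun.subspace_sum cfun.subspace_scale V_subspace perm_act_in)

lemma component_subset: "component p \<subseteq> V"
  using act_in by (auto simp: component_def)

lemma component_subspace: "cfun.subspace (component p)"
proof -
  have "cscale k (ga_act N v (ysym p)) \<in> component p" if "v \<in> V" for k v
    unfolding component_def
    by (rule image_eqI[of _ _ "cscale k v"]) (simp_all add: ga_act_scale_left that cfun.subspace_scale V_subspace)
  moreover have "0 \<in> component p"
    unfolding component_def by (rule image_eqI[of _ _ 0]) (simp_all add: cfun.subspace_0 V_subspace)
  moreover have "ga_act N v (ysym p) + ga_act N w (ysym p) \<in> component p" if "v \<in> V" "w \<in> V" for v w
    unfolding component_def
    by (rule image_eqI[of _ _ "v + w"]) (simp_all add: ga_act_add_left that cfun.subspace_add V_subspace)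
  ultimately show ?thesis unfolding cfun.subspace_def by (auto simp: component_def)
qed

lemma component_act_zero:
  assumes "w \<in> component p" "p \<in> syt N" "q \<in> syt N" "reading_less N q p"
  shows "ga_act N w (ysym q) = 0"
  using assms by (auto simp: component_def ysym_mult_zero simp flip: ga_act_mult)

lemma component_act:
  assumes "w \<in> component p" "ga_mult N (ysym p) (ysym p) = cscale \<kappa> (ysym p)"
  shows "ga_act N w (ysym p) = cscale \<kappa> w"
  using assms by (auto simp: component_def ga_act_scale_right simp flip: ga_act_mult)

text \<open>The triangular argument once more; cancellation is now division by
  \<open>\<kappa>\<close>, because \<open>c_q\<close> acts on its own component as this
  scalar.\<close>

lemma component_direct:
  assumes y: "\<And>p. p \<in> syt N \<Longrightarrow> y p \<in> component p" and "(\<Sum>p\<in>syt N. y p) = 0" "p \<in> syt N"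
  shows "y p = 0"
proof (rule triangular_sum_zero[where f = "\<lambda>q z. ga_act N z (ysym q)" and R = "reading_less N",
      OF finite_syt reading_less_order _ _ _ _ assms(2,3)])
  fix q assume q: "q \<in> syt N" "ga_act N (y q) (ysym q) = 0"
  obtain \<kappa> where "\<kappa> \<noteq> 0" "ga_mult N (ysym q) (ysym q) = cscale \<kappa> (ysym q)"
    using ysym_square[OF q(1)] by blast
  then show "y q = 0"
    using component_act[OF y[OF q(1)]] q(2) by (metis cscale_eq_0_iff)
qed (simp_all add: ga_act_sum_left component_act_zero[OF y])

lemma component_direct_sum: "internal_direct_sum V (syt N) component"
proof -
  have "\<exists>!w. w \<in> Pi\<^sub>E (syt N) component \<and> v = (\<Sum>p\<in>syt N. w p)" if v: "v \<in> V" for v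
  proof (rule ex_ex1I)
    obtain z where z: "ga_basis id = (\<Sum>p\<in>syt N. ga_mult N (z p) (ysym p))"
      using ysym_generate by blast
    have "v = ga_act N v (ga_basis id)"
      by (simp add: ga_act_basis) (simp add: perm_act_def)
    also have "\<dots> = (\<Sum>p\<in>syt N. ga_act N (ga_act N v (z p)) (ysym p))"
      unfolding z by (simp add: ga_act_sum_right ga_act_mult)
    also have "\<dots> = (\<Sum>p\<in>syt N. restrict (\<lambda>p. ga_act N (ga_act N v (z p)) (ysym p)) (syt N) p)"
      by (intro sum.cong) auto
    finally have "v = (\<Sum>p\<in>syt N. restrict (\<lambda>p. ga_act N (ga_act N v (z p)) (ysym p)) (syt N) p)" .
    moreover have "restrict (\<lambda>p. ga_act N (ga_act N v (z p)) (ysym p)) (syt N) \<in> Pi\<^sub>E (syt N) component"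
      unfolding component_def using act_in[OF v] by (intro restrict_PiE_iff[THEN iffD2]) blast
    ultimately show "\<exists>w. w \<in> Pi\<^sub>E (syt N) component \<and> v = (\<Sum>p\<in>syt N. w p)" by blast
  next
    fix w w' assume w: "w \<in> Pi\<^sub>E (syt N) component \<and> v = (\<Sum>p\<in>syt N. w p)"
      and w': "w' \<in> Pi\<^sub>E (syt N) component \<and> v = (\<Sum>p\<in>syt N. w' p)"
    have "w p - w' p = 0" if "p \<in> syt N" for p
    proof (rule component_direct[OF _ _ that])
      show "w p - w' p \<in> component p" if "p \<in> syt N" for p
        using w w' that by (intro cfun.subspace_diff component_subspace) (auto dest: PiE_mem)
      show "(\<Sum>p\<in>syt N. w p - w' p) = 0"
        using w w' by (simp add: sum_subtractf)
    qed
    then show "w = w'"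
      using w w' by (intro PiE_ext[of w "syt N" component w']) auto
  qed
  then show ?thesis
    unfolding internal_direct_sum_def
    by (intro conjI ballI finite_syt V_subspace component_subspace component_subset)
qed

section \<open>The commutant and irreducibility of the components\<close>

lemma commutant_act:
  assumes b: "b \<in> commutant" and v: "v \<in> V"
  shows "b (ga_act N v a) = ga_act N (b v) a"
proof -
  have add: "b (x + y) = b x + b y" if "x \<in> V" "y \<in> V" for x y
    using b that by (auto simp: commutant_def endomorphisms_def)
  have scale: "b (cscale c x) = cscale c (b x)" if "x \<in> V" for c x
    using b that by (auto simp: commutant_def endomorphisms_def)
  have zero: "b 0 = 0"
    using scale[OF v, of 0] by (simp add: cscale_simps)
  have sum: "b (\<Sum>g\<in>G. f g) = (\<Sum>g\<in>G. b (f g))" if "finite G" "\<And>g. g \<in> G \<Longrightarrow> f g \<in> V"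
    for f :: "(nat \<Rightarrow> nat) \<Rightarrow> (nat \<Rightarrow> nat) \<Rightarrow> complex" and G
    using that
  proof (induction G rule: finite_induct)
    case (insert g G)
    then have "(\<Sum>g\<in>G. f g) \<in> V" "f g \<in> V" by (auto intro!: cfun.subspace_sum V_subspace)
    then have "b (f g + (\<Sum>g\<in>G. f g)) = b (f g) + (\<Sum>g\<in>G. b (f g))"
      using insert.IH insert.prems by (subst add) auto
    then show ?case unfolding sum.insert[OF insert.hyps] .
  qed (simp add: zero)
  have "b (ga_act N v a) = (\<Sum>g\<in>Sym N. b (cscale (a g) (perm_act v g)))"
    unfolding ga_act_def
    by (intro sum finite_Sym cfun.subspace_scale V_subspace perm_act_in v)
  also have "\<dots> = (\<Sum>g\<in>Sym N. cscale (a g) (perm_act (b v) g))"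
    using b v by (intro sum.cong refl) (simp add: scale perm_act_in commutant_def)
  finally show ?thesis by (simp add: ga_act_def)
qed

lemma component_submodule: "submodule commutant V (component p)"
proof -
  have "b w \<in> component p" if b: "b \<in> commutant" and "w \<in> component p" for b w
  proof -
    obtain v where v: "v \<in> V" "w = ga_act N v (ysym p)"
      using \<open>w \<in> component p\<close> by (auto simp: component_def)
    have "b v \<in> V" using b v by (auto simp: commutant_def endomorphisms_def)
    then show ?thesis using commutant_act[OF b v(1)] v by (auto simp: component_def)
  qed
  then show ?thesis
    by (simp add: submodule_def component_subspace component_subset)
qed

text \<open>The endomorphism \<open>b v = (\<Sum>g. \<phi> (v \<cdot> g) (w \<cdot> g\<inverse>))\<close>, where \<open>\<phi> v\<close> is a coordinate of
  \<open>v \<cdot> c\<close>, commutes with the permutations. For \<open>u = v' \<cdot> c\<close> one has \<open>b u = w \<cdot> y\<close> with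
  \<open>y \<in> c \<complex>S\<^sub>N c = \<complex> c\<close>, so \<open>b u\<close> is a multiple of \<open>w\<close>.\<close>

lemma component_transitive:
  assumes p: "p \<in> syt N" and u: "u \<in> component p" "u \<noteq> 0" and w: "w \<in> component p"
  obtains b s where "b \<in> commutant" "w = cscale s (b u)"
proof -
  let ?c = "ysym p"
  \<comment> \<open>The coordinate defining \<open>\<phi>\<close> is one where \<open>u\<close> does
    not vanish; this will make the final scalar invertible.\<close>
  obtain m where m: "u m \<noteq> 0" using u(2) by (auto simp: fun_eq_iff)
  obtain v' where v': "v' \<in> V" "u = ga_act N v' ?c"
    using u(1) by (auto simp: component_def)
  obtain \<kappa> where \<kappa>: "\<kappa> \<noteq> 0" "ga_mult N ?c ?c = cscale \<kappa> ?c"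
    using ysym_square[OF p] by blast
  have uV: "u \<in> V" and wV: "w \<in> V" using u w subsetD[OF component_subset] by blast+
  define \<phi> where "\<phi> v = ga_act N v ?c m" for v
  define b where "b = restrict (\<lambda>v. \<Sum>g\<in>Sym N. cscale (\<phi> (perm_act v g)) (perm_act w (inv g))) V"
  have b: "b v = (\<Sum>g\<in>Sym N. cscale (\<phi> (perm_act v g)) (perm_act w (inv g)))" if "v \<in> V" for v
    using that by (simp add: b_def)
  have b_V: "b v \<in> V" if "v \<in> V" for v
    unfolding b[OF that]
    by (intro cfun.subspace_sum cfun.subspace_scale V_subspace perm_act_in wV Sym_inv)
  have "b \<in> endomorphisms V"
  proof -
    have "b (x + y) = b x + b y" if "x \<in> V" "y \<in> V" for x y
      using that cfun.subspace_add[OF V_subspace that]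
      by (simp add: b perm_act_linear \<phi>_def ga_act_add_left cscale_simps sum.distrib)
    moreover have "b (cscale k x) = cscale k (b x)" if "x \<in> V" for k x
      using that cfun.subspace_scale[OF V_subspace that, of k]
      by (simp add: b perm_act_linear \<phi>_def ga_act_scale_left cfun.scale_sum_right cscale_simps)
        (simp add: cscale_def)
    ultimately show ?thesis
      using b_V by (auto simp: endomorphisms_def b_def)
  qed
  moreover have "b (perm_act v h) = perm_act (b v) h" if v: "v \<in> V" and h: "h \<in> Sym N" for v h
  proof -
    have "b (perm_act v h) = (\<Sum>g\<in>Sym N. cscale (\<phi> (perm_act v (h \<circ> g))) (perm_act w (inv g)))"
      unfolding b[OF perm_act_in[OF v h]] by (intro sum.cong refl) (simp add: perm_act_comp[OF h])
    also have "\<dots> = (\<Sum>g\<in>Sym N. cscale (\<phi> (perm_act v (h \<circ> g))) (perm_act w (inv (h \<circ> g) \<circ> h)))"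
      by (intro sum.cong refl) (simp add: Sym_inv_comp[OF h] comp_assoc Sym_inv_o[OF h])
    also have "\<dots> = (\<Sum>g\<in>Sym N. cscale (\<phi> (perm_act v g)) (perm_act w (inv g \<circ> h)))"
      by (rule Sym_sum_left[OF h])
    also have "\<dots> = (\<Sum>g\<in>Sym N. cscale (\<phi> (perm_act v g)) (perm_act (perm_act w (inv g)) h))"
      by (intro sum.cong refl) (simp add: perm_act_comp[OF Sym_inv h])
    also have "\<dots> = perm_act (b v) h"
      by (simp add: b[OF v] fun_eq_iff perm_act_def sum_fun_apply cscale_def)
    finally show ?thesis .
  qed
  ultimately have "b \<in> commutant" by (simp add: commutant_def)
  \<comment> \<open>The matrix coefficients of \<open>v\<close> at \<open>m\<close>, arranged so
    that \<open>Y\<close> turns the action on vectors into right multiplication in the group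
    algebra.\<close>
  define Y where "Y v = (\<lambda>h. if h \<in> Sym N then perm_act v (inv h) m else 0)"
    for v :: "(nat \<Rightarrow> nat) \<Rightarrow> complex"
  define y where "y h = (if h \<in> Sym N then \<phi> (perm_act u (inv h)) else 0)" for h
  have Y_in: "Y v \<in> group_algebra N" for v by (simp add: Y_def group_algebra_def)
  have Y_act: "Y (ga_act N v a) = ga_mult N (Y v) a" for v a
  proof (rule ga_eqI[OF Y_in ga_mult_in])
    fix h assume h: "h \<in> Sym N"
    have "ga_mult N (Y v) a h = (\<Sum>g\<in>Sym N. a g * perm_act v (inv (h \<circ> inv g)) m)"
      unfolding ga_mult_eq_act[OF Y_in] ga_act_apply
      by (intro sum.cong refl) (simp add: Y_def h Sym_comp Sym_inv)
    also have "\<dots> = (\<Sum>g\<in>Sym N. a g * perm_act (perm_act v g) (inv h) m)"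
      by (intro sum.cong refl)
        (simp add: Sym_inv_comp[OF h] Sym_inv perm_act_comp[OF _ Sym_inv[OF h]])
    also have "\<dots> = Y (ga_act N v a) h"
      using h by (simp add: Y_def ga_act_def perm_act_def sum_fun_apply cscale_def)
    finally show "Y (ga_act N v a) h = ga_mult N (Y v) a h" ..
  qed
  \<comment> \<open>In \<open>\<phi>\<close> the symmetrizer acts after \<open>inv h\<close>, which
    appears here as a left factor; the right factor comes from \<open>u\<close> lying in the
    component.\<close>
  have "y = ga_mult N ?c (Y u)"
  proof (rule ga_eqI[OF _ ga_mult_in])
    show "y \<in> group_algebra N" by (simp add: y_def group_algebra_def)
    fix h assume h: "h \<in> Sym N"
    have "ga_mult N ?c (Y u) h = (\<Sum>g\<in>Sym N. ?c g * perm_act u (inv (inv g \<circ> h)) m)"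
      unfolding ga_mult_apply[OF h]
      by (intro sum.cong refl) (simp add: Y_def h Sym_comp Sym_inv)
    also have "\<dots> = (\<Sum>g\<in>Sym N. ?c g * perm_act (perm_act u (inv h)) g m)"
      by (intro sum.cong refl)
        (simp add: Sym_inv_comp[OF Sym_inv h] perm_act_comp[OF Sym_inv[OF h]])
    also have "\<dots> = y h"
      using h by (simp add: y_def \<phi>_def ga_act_def sum_fun_apply cscale_def)
    finally show "y h = ga_mult N ?c (Y u) h" ..
  qed
  then have "y = ga_mult N ?c (ga_mult N (Y v') ?c)"
    by (simp add: v'(2) Y_act)
  then obtain s where s: "y = cscale s ?c"
    using ysym_sandwich[OF p] by metis
  \<comment> \<open>The coefficient at the identity is \<open>\<phi> u\<close>, which is non-zero by
    the choice of \<open>m\<close>; hence \<open>s\<close> cannot be 0.\<close>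
  have "y id = \<kappa> * u m"
    using component_act[OF u(1) \<kappa>(2)] by (simp add: y_def \<phi>_def perm_act_def cscale_def)
  then have "s \<noteq> 0"
    using s m \<kappa>(1) by (auto simp: cscale_simps)
  have "b u = (\<Sum>g\<in>Sym N. cscale (\<phi> (perm_act u (inv g))) (perm_act w (inv (inv g))))"
    unfolding b[OF uV] by (rule Sym_sum_inv[symmetric])
  also have "\<dots> = ga_act N w y"
    unfolding ga_act_def by (intro sum.cong refl) (simp add: y_def)
  also have "\<dots> = cscale (s * \<kappa>) w"
    by (simp add: s ga_act_scale_right component_act[OF w \<kappa>(2)] cscale_simps)
  finally have "w = cscale (1 / (s * \<kappa>)) (b u)"
    using \<open>s \<noteq> 0\<close> \<kappa>(1) by (simp add: cscale_simps)
  with \<open>b \<in> commutant\<close> show ?thesis by (rule that)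
qed

lemma component_irreducible:
  assumes p: "p \<in> syt N" and "component p \<noteq> {0}"
  shows "irreducible_submodule commutant V (component p)"
proof -
  have "U = component p" if U: "submodule commutant V U" "U \<subseteq> component p" "U \<noteq> {0}" for U
  proof -
    have sub: "cfun.subspace U" using U(1) by (simp add: submodule_def)
    then obtain u where u: "u \<in> U" "u \<noteq> 0"
      using U(3) cfun.subspace_0[OF sub] by blast
    have "w \<in> U" if w: "w \<in> component p" for w
    proof -
      obtain b s where "b \<in> commutant" "w = cscale s (b u)"
        using component_transitive[OF p _ u(2) w] u(1) U(2) by blast
      then show ?thesis
        using U(1) u(1) cfun.subspace_scale[OF sub] by (simp add: submodule_def)
    qed
    then show ?thesis using U(2) by blast
  qed
  then show ?thesis
    using component_submodule assms(2) by (auto simp: irreducible_submodule_def)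
qed

end

section \<open>Invariant tensors\<close>

text \<open>The same matrix acts in every tensor factor, so relabelling the positions of both
  indices permutes the factors of each product.\<close>

lemma tensor_rep_perm_act:
  assumes \<sigma>: "\<sigma> \<in> Sym N"
  shows "tensor_rep n N u (perm_act t \<sigma>) = perm_act (tensor_rep n N u t) \<sigma>"
proof
  fix m
  have s: "\<sigma> permutes {1..N}" using \<sigma> by (simp add: Sym_def)
  let ?M = "\<lambda>k l. spin_mat n u k l"
  have "(\<Sum>m'\<in>multi_indices n N. (\<Prod>i\<in>{1..N}. ?M (m i) (m' i)) * t (m' \<circ> inv \<sigma>))
      = (\<Sum>m'\<in>multi_indices n N. (\<Prod>i\<in>{1..N}. ?M (m (inv \<sigma> i)) (m' i)) * t m')"
  proof (rule sum.reindex_bij_witness[of _ "\<lambda>m. m \<circ> \<sigma>" "\<lambda>m. m \<circ> inv \<sigma>"])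
    fix m' assume m': "m' \<in> multi_indices n N"
    show "m' \<circ> inv \<sigma> \<circ> \<sigma> = m'" "m' \<circ> \<sigma> \<circ> inv \<sigma> = m'"
      by (rule Sym_cancel[OF \<sigma>])+
    show "m' \<circ> inv \<sigma> \<in> multi_indices n N"
      using m' comp_inv_multi_indices[OF \<sigma>] by blast
    show "m' \<circ> \<sigma> \<in> multi_indices n N"
      using m' comp_inv_multi_indices[OF Sym_inv[OF \<sigma>]] Sym_inv_o(3)[OF \<sigma>] by metis
    have "(\<Prod>i\<in>{1..N}. ?M (m (inv \<sigma> i)) ((m' \<circ> inv \<sigma>) i)) = (\<Prod>i\<in>{1..N}. ?M (m i) (m' i))"
      by (subst prod.permute[OF s]) (simp add: permutes_inverses[OF s])
    then show "(\<Prod>i\<in>{1..N}. ?M (m (inv \<sigma> i)) ((m' \<circ> inv \<sigma>) i)) * t (m' \<circ> inv \<sigma>)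
        = (\<Prod>i\<in>{1..N}. ?M (m i) (m' i)) * t (m' \<circ> inv \<sigma>)" by simp
  qed
  then show "tensor_rep n N u (perm_act t \<sigma>) m = perm_act (tensor_rep n N u t) \<sigma> m"
    by (simp add: tensor_rep_def perm_act_def comp_inv_multi_indices[OF \<sigma>])
qed

lemma tensor_rep_linear:
  "tensor_rep n N u (s + t) = tensor_rep n N u s + tensor_rep n N u t"
  "tensor_rep n N u (cscale c t) = cscale c (tensor_rep n N u t)"
  "tensor_rep n N u 0 = 0"
  by (simp_all add: tensor_rep_def fun_eq_iff cscale_def algebra_simps sum.distrib sum_distrib_left)

lemma Inv_perm_module: "perm_module N (Inv j N)"
proof
  show "cfun.subspace (Inv j N)"
    unfolding cfun.subspace_def Inv_def Let_def
    by (auto simp: tensor_rep_linear) (auto simp: tensors_def cscale_def)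
  show "perm_act v \<sigma> \<in> Inv j N" if "v \<in> Inv j N" "\<sigma> \<in> Sym N" for v \<sigma>
    using that unfolding Inv_def Let_def
    by (auto simp: tensor_rep_perm_act)
      (auto simp: tensors_def perm_act_def comp_inv_multi_indices)
qed

section \<open>The normalizing factor is non-zero\<close>

lemma sum_list_take_mono:
  fixes lam :: "nat list"
  assumes "r \<le> r'"
  shows "sum_list (take r lam) \<le> sum_list (take r' lam)"
proof -
  have "take r' lam = take r lam @ take (r' - r) (drop r lam)"
    using assms take_add[of r "r' - r" lam] by simp
  then show ?thesis by simp
qed

lemma canonical_tableau_in: "canonical_tableau lam \<in> tableaux lam"
proof -
  define t where "t = (\<lambda>(r, c). sum_list (take r lam) + c + 1)"
  \<comment> \<open>The entries of row \<open>r\<close> stop at the sum of the first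
    \<open>r + 1\<close> row lengths, after which the next row starts: different rows fill disjoint
    intervals.\<close>
  have upper: "t (r, c) \<le> sum_list (take (Suc r) lam)" if "(r, c) \<in> boxes lam" for r c
    using that by (simp add: t_def boxes_def take_Suc_conv_app_nth)
  have inj: "inj_on t (boxes lam)"
  proof (rule inj_onI)
    have *: "\<not> r < r'" if "(r, c) \<in> boxes lam" "t (r, c) = t (r', c')" for r c r' c'
    proof
      assume "r < r'"
      then have "sum_list (take (Suc r) lam) \<le> sum_list (take r' lam)"
        by (intro sum_list_take_mono) simp
      then show False using upper[OF that(1)] that(2) by (simp add: t_def)
    qed
    fix b b' assume "b \<in> boxes lam" "b' \<in> boxes lam" "t b = t b'"
    moreover obtain r c r' c' where bb: "b = (r, c)" "b' = (r', c')" by (cases b, cases b')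
    ultimately have "r = r'" using *[of r c r' c'] *[of r' c' r c] by (simp add: linorder_neq_iff)
    then show "b = b'" using \<open>t b = t b'\<close> by (simp add: bb t_def)
  qed
  have "t b \<in> {1..sum_list lam}" if "b \<in> boxes lam" for b
  proof -
    obtain r c where b: "b = (r, c)" by (cases b)
    have "sum_list (take (Suc r) lam) \<le> sum_list (take (max (Suc r) (length lam)) lam)"
      by (rule sum_list_take_mono) simp
    then show ?thesis using upper[of r c] that by (simp add: b) (simp add: t_def)
  qed
  then have "t ` boxes lam = {1..sum_list lam}"
    using card_boxes[of lam] card_image[OF inj] by (intro card_subset_eq) auto
  then have "bij_betw t (boxes lam) {1..sum_list lam}"
    using inj by (simp add: bij_betw_def)
  then have "bij_betw (restrict t (boxes lam)) (boxes lam) {1..sum_list lam}"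
    by (rule bij_betw_cong[THEN iffD1, rotated]) simp
  then show ?thesis
    unfolding tableaux_def canonical_tableau_def t_def by simp
qed

text \<open>The module contains the non-zero symmetrizer itself. A basis of cardinality 0 could also
  be infinite; the finite spanning set of the group algebra excludes this.\<close>

lemma dim_specht_module: "cfun.dim (specht_module lam) \<noteq> 0"
proof
  let ?N = "sum_list lam" and ?c = "young_symmetrizer lam (canonical_tableau lam)"
  assume "cfun.dim (specht_module lam) = 0"
  moreover obtain B where B: "B \<subseteq> specht_module lam" "cfun.independent B"
    "specht_module lam \<subseteq> cfun.span B" "card B = cfun.dim (specht_module lam)"
    by (rule cfun.basis_exists)
  moreover have "specht_module lam \<subseteq> cfun.span (ga_basis ` Sym ?N)"
    unfolding specht_module_def group_algebra_span[symmetric] by auto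
  ultimately have "B = {}"
    using cfun.independent_span_bound[of "ga_basis ` Sym ?N" B] by auto
  then have "specht_module lam \<subseteq> {0}" using B by simp
  moreover have "?c \<in> specht_module lam"
    unfolding specht_module_def
    by (rule image_eqI[of _ _ "ga_basis id"]) (simp_all add: ga_mult_one young_symmetrizer_in)
  ultimately show False
    using young_symmetrizer_nonzero[OF canonical_tableau_in] by blast
qed

text \<open>The non-zero scalar is moved onto the vector, and scaling maps \<open>V\<close> onto
  itself.\<close>

lemma (in perm_module) young_idempotent_image:
  "(\<lambda>v. ga_act N v (young_idempotent lam T)) ` V = component (lam, T)"
proof -
  define k :: complex where "k = of_nat (cfun.dim (specht_module lam)) / fact (sum_list lam)"
  have k: "k \<noteq> 0" by (simp add: k_def dim_specht_module)
  have e: "ga_act N v (young_idempotent lam T) = ga_act N (cscale k v) (ysym (lam, T))" for v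
    by (simp add: young_idempotent_def ysym_def ga_act_scale_right ga_act_scale_left k_def)
  have "cscale k ` V = V"
  proof
    show "cscale k ` V \<subseteq> V" by (auto intro: cfun.subspace_scale V_subspace)
    show "V \<subseteq> cscale k ` V"
    proof
      fix v assume "v \<in> V"
      then show "v \<in> cscale k ` V"
        using k cfun.subspace_scale[OF V_subspace]
        by (intro image_eqI[of _ _ "cscale (1 / k) v"]) (auto simp: cscale_simps)
    qed
  qed
  moreover have "(\<lambda>v. ga_act N (cscale k v) (ysym (lam, T))) ` V
      = (\<lambda>v. ga_act N v (ysym (lam, T))) ` (cscale k ` V)"
    by (simp only: image_image)
  ultimately show ?thesis unfolding e component_def by simp
qed

section \<open>The decomposition of the invariant tensors\<close>

theorem theorem2:
  fixes j :: real and N :: nat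
  assumes "2 * j \<in> \<nat>" and "N \<ge> 1"
  shows "(\<forall>\<iota>\<in>Inv j N. \<forall>\<sigma>\<in>Sym N. perm_act \<iota> \<sigma> \<in> Inv j N) \<and>
    internal_direct_sum (Inv j N) (SIGMA lam:young_diagrams N. standard_tableaux lam)
      (\<lambda>(lam, T). Inv_tableau j N lam T) \<and>
    (\<forall>lam\<in>young_diagrams N. \<forall>T\<in>standard_tableaux lam.
      submodule (commutator_algebra j N) (Inv j N) (Inv_tableau j N lam T) \<and>
      (Inv_tableau j N lam T = {0} \<or>
       irreducible_submodule (commutator_algebra j N) (Inv j N) (Inv_tableau j N lam T)))"
proof -
  interpret perm_module N "Inv j N" by (rule Inv_perm_module)
  have comp: "Inv_tableau j N lam T = component (lam, T)" for lam T
    unfolding Inv_tableau_def by (rule young_idempotent_image)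
  have alg: "commutator_algebra j N = commutant"
    unfolding commutator_algebra_def commutant_def ..
  have sum: "internal_direct_sum (Inv j N) (SIGMA lam:young_diagrams N. standard_tableaux lam)
      (\<lambda>(lam, T). Inv_tableau j N lam T)"
    using component_direct_sum by (simp add: comp syt_def)
  have "(lam, T) \<in> syt N" if "lam \<in> young_diagrams N" "T \<in> standard_tableaux lam" for lam T
    using that by (simp add: syt_def)
  then show ?thesis
    using perm_act_in sum component_submodule component_irreducible unfolding comp alg by blast
qed

end
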